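(* Let $p\in(0,1)$ be fixed. For each $n$, let $G_0\sim \mathrm{ER}(n,p)$ on vertex set $V$ with $|V|=n$, and let $(G_t)_{t\ge 0}$ be the sequence of graphs produced by the standard edgelighter walk started from $G_0$ with parameters $1-q_1=q_2=p$ and with the walker's starting vertex chosen uniformly at random from $V$. Let $A_t$ denote the adjacency matrix of $G_t$. Let $\alpha,c>0$ be fixed constants such that $\alpha>5c$. If $t\le c\,n^2\log n$, then $G_0$ and $G_t$ are $\alpha$-matchable; specifically, $$\mathbb{P}\left[\exists\, P\in\bigcup_{k\ge n^\alpha}\Pi_{n,k}\ \text{ s.t. }\ \operatorname{Tr}(A_0PA_tP^T)\ge \operatorname{Tr}(A_0A_t)\right]\le 2\exp\left\{-\Omega\left(\frac{n^{2\alpha-5c}}{\log n}\right)\right\}.$$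
   Context: $\mathrm{ER}(n,p)$ is the Erdős–Rényi random graph on $n$ vertices: each of the $\binom n2$ unordered pairs is an edge independently with probability $p$. Standard edgelighter walk with parameters $q_1,q_2$: a time-homogeneous Markov chain $Z_t=(L_t,G_t)$ on $V\times\{0,1\}^{\binom V2}$, where $L_t\in V$ is the walker's position and $G_t$ is the current graph on $V$ (encoded by the indicator of its edge set). If at time $t$ the walker is at $u$, it selects $v\in V$ uniformly at random ($v=u$ allowed, probability $1/n$ each), independently of the past, and moves to $v$. If $v=u$, then $G_{t+1}=G_t$. If $v\ne u$, only the status of the pair $\{u,v\}$ may change: if $\{u,v\}$ is an edge of $G_t$, it is removed with probability $q_1$ (and kept with probability $1-q_1$); if $\{u,v\}$ is a non-edge of $G_t$, it is added with probability $q_2$ (and left absent with probability $1-q_2$). These random switches are independent of the walker and of the graph history. $\Pi_{n,k}$ is the set of $n\times n$ permutation matrices whose associated permutation moves (does not fix) exactly $k$ of the $n$ labels. Two graphs on the same vertex set with adjacency matrices $A,B$ are called $\alpha$-matchable if $\mathbb{P}[\exists P\in\bigcup_{k\ge n^\alpha}\Pi_{n,k}:\operatorname{Tr}(APBP^T)\ge\operatorname{Tr}(AB)]=o(1)$ as $n\to\infty$. Asymptotics are as $n\to\infty$: $f(n)=\Omega(g(n))$ means there are $C>0$, $n_0$ with $f(n)\ge C g(n)$ for all $n\ge n_0$. *)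

theory Defs
  imports "HOL-Probability.Probability" "Jordan_Normal_Form.Matrix"
begin

text \<open>Graphs on the vertex set \<open>{0..<n}\<close> are indicator functions of their edge sets:
  functions \<open>nat set \<Rightarrow> bool\<close> that are \<open>False\<close> outside of \<open>vertex_pairs n\<close>.\<close>

type_synonym graph = "nat set \<Rightarrow> bool"

definition vertex_pairs :: "nat \<Rightarrow> nat set set" where
  "vertex_pairs n = {e. e \<subseteq> {0..<n} \<and> card e = 2}"

definition ER :: "nat \<Rightarrow> real \<Rightarrow> graph pmf" where
  "ER n p = Pi_pmf (vertex_pairs n) False (\<lambda>_. bernoulli_pmf p)"

definition adjacency_mat :: "nat \<Rightarrow> graph \<Rightarrow> real mat" where
  "adjacency_mat n G = mat n n (\<lambda>(i, j). if i \<noteq> j \<and> G {i, j} then 1 else 0)"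

text \<open>A state of the edgelighter walk is a pair (position of the walker, current graph).\<close>

definition edgelighter_step ::
    "nat \<Rightarrow> real \<Rightarrow> real \<Rightarrow> nat \<times> graph \<Rightarrow> (nat \<times> graph) pmf" where
  "edgelighter_step n q1 q2 = (\<lambda>(u, G).
     bind_pmf (pmf_of_set {0..<n}) (\<lambda>v.
       if v = u then return_pmf (v, G)
       else map_pmf (\<lambda>b. (v, G({u, v} := b)))
              (bernoulli_pmf (if G {u, v} then 1 - q1 else q2))))"

text \<open>The \<open>t\<close>-step transition kernel: the law of \<open>Z\<^sub>t\<close> given \<open>Z\<^sub>0 = z\<close>.\<close>

primrec edgelighter_walk ::
    "nat \<Rightarrow> real \<Rightarrow> real \<Rightarrow> nat \<Rightarrow> nat \<times> graph \<Rightarrow> (nat \<times> graph) pmf" where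
  "edgelighter_walk n q1 q2 0 z = return_pmf z"
| "edgelighter_walk n q1 q2 (Suc t) z =
     bind_pmf (edgelighter_walk n q1 q2 t z) (edgelighter_step n q1 q2)"

text \<open>The joint law of \<open>(G\<^sub>0, G\<^sub>t)\<close> when \<open>G\<^sub>0\<close> is \<open>ER n p\<close> and the walker starts at an
  independent uniformly random vertex.\<close>

definition edgelighter_graphs ::
    "nat \<Rightarrow> real \<Rightarrow> real \<Rightarrow> real \<Rightarrow> nat \<Rightarrow> (graph \<times> graph) pmf" where
  "edgelighter_graphs n p q1 q2 t =
     bind_pmf (pair_pmf (pmf_of_set {0..<n}) (ER n p)) (\<lambda>z.
       map_pmf (\<lambda>z'. (snd z, snd z')) (edgelighter_walk n q1 q2 t z))"

definition perm_mat :: "nat \<Rightarrow> (nat \<Rightarrow> nat) \<Rightarrow> real mat" where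
  "perm_mat n \<sigma> = mat n n (\<lambda>(i, j). if \<sigma> i = j then 1 else 0)"

definition perm_mats_moving :: "nat \<Rightarrow> nat \<Rightarrow> real mat set" where
  "perm_mats_moving n k =
     {perm_mat n \<sigma> |\<sigma>. \<sigma> permutes {0..<n} \<and> card {i \<in> {0..<n}. \<sigma> i \<noteq> i} = k}"

definition mat_trace :: "real mat \<Rightarrow> real" where
  "mat_trace A = (\<Sum>i\<in>{0..<dim_row A}. A $$ (i, i))"

text \<open>The event that some permutation moving at least \<open>n\<^sup>\<alpha>\<close> labels aligns the two graphs at
  least as well as the identity does.\<close>

definition mismatch_event :: "real \<Rightarrow> nat \<Rightarrow> (graph \<times> graph) set" where
  "mismatch_event \<alpha> n = {(G, H).
     \<exists>P \<in> (\<Union>k\<in>{k. real k \<ge> real n powr \<alpha>}. perm_mats_moving n k).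
       mat_trace (adjacency_mat n G * P * adjacency_mat n H * transpose_mat P)
         \<ge> mat_trace (adjacency_mat n G * adjacency_mat n H)}"

text \<open>Matchability is an asymptotic property of a sequence of random pairs of graphs, given here
  by their joint laws, the \<open>n\<close>-th pair living on the vertex set \<open>{0..<n}\<close>.\<close>

definition alpha_matchable :: "real \<Rightarrow> (nat \<Rightarrow> (graph \<times> graph) pmf) \<Rightarrow> bool" where
  "alpha_matchable \<alpha> \<mu> \<longleftrightarrow>
     (\<lambda>n. measure_pmf.prob (\<mu> n) (mismatch_event \<alpha> n)) \<longlonglongrightarrow> 0"

end

theory Submission
  imports Defs "HOL-Real_Asymp.Real_Asymp"
begin

text \<open>Since \<open>1 - q\<^sub>1 = q\<^sub>2 = p\<close>, every traversed pair is resampled from \<open>Bernoulli p\<close>. Hence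
  \<open>(G\<^sub>0, G\<^sub>t)\<close> is a function of independent data: a path of \<open>t + 1\<close> uniform vertices and two
  independent Erdos-Renyi graphs \<open>G, H\<close>, with \<open>G\<^sub>0 = G\<close> and \<open>G\<^sub>t\<close> equal to \<open>H\<close> on the touched pairs and
  to \<open>G\<close> elsewhere. For a permutation \<open>\<sigma>\<close> moving \<open>k\<close> labels, the gain (half the difference of the two
  traces) has mean \<open>p (1 - p)\<close> times the expected number of untouched pairs moved by \<open>\<sigma>\<close>, which is at
  least of order \<open>k n\<^sup>1\<^sup>-\<^sup>5\<^sup>c\<^sup>/\<^sup>2\<close>; changing one of the \<open>O(n\<^sup>2 log n)\<close> independent inputs changes the gain
  by \<open>O(1)\<close>. McDiarmid's inequality, applied once to all inputs together, bounds the probability of a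
  non-positive gain by \<open>exp (- C k\<^sup>2 n\<^sup>-\<^sup>5\<^sup>c / log n)\<close>. This beats the number of permutations moving \<open>k\<close>
  labels, at most \<open>n\<^sup>2\<^sup>k\<close>, as soon as \<open>k \<ge> n\<^sup>\<alpha>\<close> with \<open>\<alpha> > 5 c\<close>.\<close>

subsection \<open>Concentration under bounded differences\<close>

lemma expectation_pair_pmf_finite:
  fixes f :: "'a \<times> 'b \<Rightarrow> real"
  assumes "finite (set_pmf A)" "finite (set_pmf B)"
  shows "measure_pmf.expectation (pair_pmf A B) f =
    measure_pmf.expectation B (\<lambda>y. measure_pmf.expectation A (\<lambda>x. f (x, y)))"
proof -
  have "measure_pmf.expectation (pair_pmf A B) f =
      (\<Sum>z\<in>set_pmf A \<times> set_pmf B. pmf (pair_pmf A B) z *\<^sub>R f z)"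
    using assms by (intro integral_measure_pmf) auto
  also have "\<dots> = (\<Sum>x\<in>set_pmf A. \<Sum>y\<in>set_pmf B. pmf A x * pmf B y * f (x, y))"
    by (simp add: sum.cartesian_product pmf_pair case_prod_unfold mult.assoc
        cong: sum.cong flip: pmf_pair)
  also have "\<dots> = (\<Sum>y\<in>set_pmf B. pmf B y * (\<Sum>x\<in>set_pmf A. pmf A x * f (x, y)))"
    by (subst sum.swap) (simp add: sum_distrib_left algebra_simps)
  also have "\<dots> = measure_pmf.expectation B (\<lambda>y. measure_pmf.expectation A (\<lambda>x. f (x, y)))"
    using assms by (simp add: integral_measure_pmf[of "set_pmf A"] integral_measure_pmf[of "set_pmf B"])
  finally show ?thesis .
qed

lemma expectation_mono_finite:
  fixes f g :: "'a \<Rightarrow> real"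
  assumes "finite (set_pmf M)" "\<And>x. x \<in> set_pmf M \<Longrightarrow> f x \<le> g x"
  shows "measure_pmf.expectation M f \<le> measure_pmf.expectation M g"
  using assms by (intro integral_mono_AE integrable_measure_pmf_finite) (auto simp: AE_measure_pmf_iff)

lemma expectation_diff_le:
  fixes f g :: "'a \<Rightarrow> real"
  assumes "finite (set_pmf M)" "\<And>x. \<bar>f x - g x\<bar> \<le> c"
  shows "\<bar>measure_pmf.expectation M f - measure_pmf.expectation M g\<bar> \<le> c"
proof -
  have "\<bar>measure_pmf.expectation M f - measure_pmf.expectation M g\<bar> =
      \<bar>measure_pmf.expectation M (\<lambda>x. f x - g x)\<bar>"
    using assms by (simp add: integrable_measure_pmf_finite)
  also have "\<dots> \<le> measure_pmf.expectation M (\<lambda>x. \<bar>f x - g x\<bar>)"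
    by (rule integral_abs_bound)
  also have "\<dots> \<le> measure_pmf.expectation M (\<lambda>x. c)"
    using assms by (intro expectation_mono_finite)
  finally show ?thesis by simp
qed

text \<open>\<open>K\<close> stands for a sum of squared ranges:
  \<open>exp (s\<^sup>2 * K / 8)\<close> is Hoeffding's bound for a variable whose squared range is
  \<open>K\<close>. Restricting to \<open>s > 0\<close> yields upper tails; lower tails are reached
  by negating \<open>f\<close>.\<close>

definition subgaussian :: "'a pmf \<Rightarrow> ('a \<Rightarrow> real) \<Rightarrow> real \<Rightarrow> bool" where
  "subgaussian M f K \<longleftrightarrow>
     (\<forall>s>0. measure_pmf.expectation M (\<lambda>x. exp (s * (f x - measure_pmf.expectation M f)))
        \<le> exp (s\<^sup>2 * K / 8))"

lemma subgaussian_range: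
  assumes fin: "finite (set_pmf M)" and c: "\<And>x y. \<bar>f x - f y\<bar> \<le> c"
  shows "subgaussian M f (c\<^sup>2)"
  unfolding subgaussian_def
proof (intro allI impI)
  fix s :: real assume "s > 0"
  \<comment> \<open>Hoeffding's lemma wants an interval. The minimum over the finite support is
    attained at some \<open>x0\<close>, so the oscillation bound from \<open>x0\<close> caps every
    value at \<open>a + c\<close>.\<close>
  define a where "a = Min (f ` set_pmf M)"
  have "a \<in> f ` set_pmf M" unfolding a_def
    using fin by (intro Min_in) (auto simp: set_pmf_not_empty)
  then obtain x0 where x0: "a = f x0" by blast
  interpret interval_bounded_random_variable "measure_pmf M" f a "a + c"
  proof unfold_locales
    have "a \<le> f x" if "x \<in> set_pmf M" for x
      unfolding a_def using fin that by (intro Min_le) auto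
    moreover have "f x \<le> a + c" for x using c[of x x0] x0 by linarith
    ultimately show "AE x in measure_pmf M. f x \<in> {a..a + c}"
      by (auto simp: AE_measure_pmf_iff)
  qed simp
  have "ennreal (measure_pmf.expectation M (\<lambda>x. exp (s * (f x - measure_pmf.expectation M f)))) =
      nn_integral M (\<lambda>x. exp (s * (f x - measure_pmf.expectation M f)))"
    using fin by (subst nn_integral_eq_integral) (auto intro: integrable_measure_pmf_finite)
  also have "\<dots> \<le> ennreal (exp (s\<^sup>2 * (a + c - a)\<^sup>2 / 8))"
    by (rule Hoeffdings_lemma_nn_integral) fact
  finally show "measure_pmf.expectation M (\<lambda>x. exp (s * (f x - measure_pmf.expectation M f)))
      \<le> exp (s\<^sup>2 * c\<^sup>2 / 8)"
    by simp
qed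

text \<open>One martingale step: with \<open>g\<close> the conditional mean given \<open>y\<close>,
  \<open>f - m\<close> splits into \<open>f (x, y) - g y\<close> and \<open>g y - m\<close>. The
  inner exponential moment is bounded uniformly in \<open>y\<close>, so it factors out and the
  exponents add.\<close>

lemma subgaussian_pair:
  assumes fin: "finite (set_pmf A)" "finite (set_pmf B)"
    and 1: "\<And>y. subgaussian A (\<lambda>x. f (x, y)) K1"
    and 2: "subgaussian B (\<lambda>y. measure_pmf.expectation A (\<lambda>x. f (x, y))) K2"
  shows "subgaussian (pair_pmf A B) f (K1 + K2)"
  unfolding subgaussian_def
proof (intro allI impI)
  fix s :: real assume s: "s > 0"
  define g where "g = (\<lambda>y. measure_pmf.expectation A (\<lambda>x. f (x, y)))"
  define m where "m = measure_pmf.expectation B g"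
  have m: "measure_pmf.expectation (pair_pmf A B) f = m"
    using fin by (simp add: expectation_pair_pmf_finite m_def g_def)
  have "measure_pmf.expectation (pair_pmf A B) (\<lambda>z. exp (s * (f z - m))) =
      measure_pmf.expectation B (\<lambda>y. exp (s * (g y - m)) *
        measure_pmf.expectation A (\<lambda>x. exp (s * (f (x, y) - g y))))"
    using fin by (simp add: expectation_pair_pmf_finite algebra_simps flip: exp_add integral_mult_right_zero)
  also have "\<dots> \<le> measure_pmf.expectation B (\<lambda>y. exp (s * (g y - m)) * exp (s\<^sup>2 * K1 / 8))"
    using 1 s unfolding subgaussian_def g_def
    by (intro expectation_mono_finite fin mult_left_mono) auto
  also have "\<dots> = measure_pmf.expectation B (\<lambda>y. exp (s * (g y - m))) * exp (s\<^sup>2 * K1 / 8)"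
    by simp
  also have "\<dots> \<le> exp (s\<^sup>2 * K2 / 8) * exp (s\<^sup>2 * K1 / 8)"
    using 2 s unfolding subgaussian_def m_def g_def by (intro mult_right_mono) auto
  also have "\<dots> = exp (s\<^sup>2 * (K1 + K2) / 8)"
    by (simp add: algebra_simps add_divide_distrib flip: exp_add)
  finally show "measure_pmf.expectation (pair_pmf A B)
      (\<lambda>z. exp (s * (f z - measure_pmf.expectation (pair_pmf A B) f))) \<le> exp (s\<^sup>2 * (K1 + K2) / 8)"
    unfolding m .
qed

lemma subgaussian_map: "subgaussian (map_pmf h M) f K \<longleftrightarrow> subgaussian M (f \<circ> h) K"
  by (simp add: subgaussian_def o_def)

lemma finite_set_Pi_pmf:
  assumes "finite A" "\<And>x. x \<in> A \<Longrightarrow> finite (set_pmf (p x))"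
  shows "finite (set_pmf (Pi_pmf A d p))"
  using assms by (auto simp: set_Pi_pmf)

text \<open>McDiarmid's inequality in moment generating form. The induction peels off one coordinate
  through \<open>subgaussian_pair\<close>, the others being averaged out first.\<close>

lemma subgaussian_bounded_differences:
  assumes "finite A" "\<And>x. x \<in> A \<Longrightarrow> finite (set_pmf (p x))"
    and "\<And>x h y. x \<in> A \<Longrightarrow> \<bar>f (h(x := y)) - f h\<bar> \<le> c x"
  shows "subgaussian (Pi_pmf A d p) f (\<Sum>x\<in>A. (c x)\<^sup>2)"
  using assms
proof (induction A arbitrary: f rule: finite_induct)
  case empty
  show ?case by (simp add: subgaussian_def)
next
  case (insert x A)
  define B where "B = Pi_pmf A d p"
  have fin: "finite (set_pmf B)" "finite (set_pmf (p x))"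
    using insert by (auto simp: B_def intro!: finite_set_Pi_pmf)
  have "subgaussian (pair_pmf B (p x)) (\<lambda>(h, y). f (h(x := y))) ((\<Sum>z\<in>A. (c z)\<^sup>2) + (c x)\<^sup>2)"
  proof (rule subgaussian_pair)
    show "subgaussian B (\<lambda>h. case (h, y) of (h, y) \<Rightarrow> f (h(x := y))) (\<Sum>z\<in>A. (c z)\<^sup>2)" for y
      unfolding B_def prod.case
    proof (rule insert.IH)
      fix z h w assume "z \<in> A"
      then have "(h(z := w))(x := y) = (h(x := y))(z := w)" using insert.hyps by auto
      then show "\<bar>f ((h(z := w))(x := y)) - f (h(x := y))\<bar> \<le> c z"
        using insert.prems(2)[of z "h(x := y)" w] \<open>z \<in> A\<close> by (simp del: fun_upd_apply)
    qed (use insert in auto)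
    \<comment> \<open>Averaging over the other coordinates keeps the oscillation in \<open>x\<close>
      at most \<open>c x\<close>, so Hoeffding's lemma applies to the conditional mean.\<close>
    show "subgaussian (p x)
        (\<lambda>y. measure_pmf.expectation B (\<lambda>h. case (h, y) of (h, y) \<Rightarrow> f (h(x := y)))) ((c x)\<^sup>2)"
    proof (intro subgaussian_range expectation_diff_le fin)
      fix y y' h
      show "\<bar>(case (h, y) of (h, y) \<Rightarrow> f (h(x := y))) - (case (h, y') of (h, y) \<Rightarrow> f (h(x := y)))\<bar> \<le> c x"
        using insert.prems(2)[of x "h(x := y')" y] by (simp del: fun_upd_apply)
    qed
  qed (use fin in auto)
  moreover have "Pi_pmf (insert x A) d p = map_pmf (\<lambda>(h, y). h(x := y)) (pair_pmf B (p x))"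
    using insert by (simp add: Pi_pmf_insert B_def pair_commute_pmf[of "p x"] pmf.map_comp o_def case_prod_unfold)
  ultimately show ?case
    using insert by (simp add: subgaussian_map o_def case_prod_unfold add.commute)
qed

lemma subgaussian_tail:
  assumes fin: "finite (set_pmf M)" and sg: "subgaussian M f K" and "K > 0" "\<delta> > 0"
  shows "measure_pmf.prob M {x. f x \<ge> measure_pmf.expectation M f + \<delta>} \<le> exp (- 2 * \<delta>\<^sup>2 / K)"
proof -
  define m where "m = measure_pmf.expectation M f"
  \<comment> \<open>Minimises the Chernoff exponent
    \<open>- s * \<delta> + s\<^sup>2 * K / 8\<close>.\<close>
  define s where "s = 4 * \<delta> / K"
  have s: "s > 0" using assms by (simp add: s_def)
  have "measure_pmf.prob M {x. f x \<ge> m + \<delta>} =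
      measure_pmf.expectation M (indicator {x. f x \<ge> m + \<delta>})" by simp
  also have "\<dots> \<le> measure_pmf.expectation M (\<lambda>x. exp (- s * \<delta>) * exp (s * (f x - m)))"
  proof (rule expectation_mono_finite[OF fin])
    fix x
    have "1 \<le> exp (- s * \<delta> + s * (f x - m))" if "f x \<ge> m + \<delta>"
      using mult_left_mono[of \<delta> "f x - m" s] s that by simp
    then show "indicator {x. f x \<ge> m + \<delta>} x \<le> exp (- s * \<delta>) * exp (s * (f x - m))"
      by (auto simp: indicator_def simp flip: exp_add)
  qed
  also have "\<dots> = exp (- s * \<delta>) * measure_pmf.expectation M (\<lambda>x. exp (s * (f x - m)))"
    by simp
  also have "\<dots> \<le> exp (- s * \<delta>) * exp (s\<^sup>2 * K / 8)"
    using sg s by (intro mult_left_mono) (auto simp: subgaussian_def m_def)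
  also have "\<dots> = exp (- 2 * \<delta>\<^sup>2 / K)"
    using \<open>K > 0\<close> by (simp add: s_def field_simps power2_eq_square flip: exp_add)
  finally show ?thesis by (simp add: m_def)
qed

subsection \<open>The law of the walk\<close>

text \<open>Redrawing one coordinate is stationary for a product law. This lets a traversal act on
  \<open>H\<close> without tracking whether the pair was traversed before.\<close>

lemma Pi_pmf_resample:
  assumes "finite A" "e \<in> A"
  shows "bind_pmf (Pi_pmf A d p) (\<lambda>h. map_pmf (\<lambda>b. h(e := b)) (p e)) = Pi_pmf A d p"
proof -
  have "Pi_pmf A d p = Pi_pmf (insert e (A - {e})) d p"
    using assms by (simp add: insert_absorb)
  also have "\<dots> = bind_pmf (p e) (\<lambda>b. bind_pmf (Pi_pmf (A - {e}) d p) (\<lambda>h. return_pmf (h(e := b))))"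
    using assms by (subst Pi_pmf_insert') auto
  also have "\<dots> = bind_pmf (p e) (\<lambda>b. bind_pmf (Pi_pmf A d p) (\<lambda>h. return_pmf (h(e := b))))"
    using assms by (simp add: Pi_pmf_remove bind_map_pmf)
  also have "\<dots> = bind_pmf (Pi_pmf A d p) (\<lambda>h. map_pmf (\<lambda>b. h(e := b)) (p e))"
    by (subst bind_commute_pmf) (simp add: map_pmf_def)
  finally show ?thesis ..
qed

text \<open>The walker's next vertex is uniform whatever its position and the graph, so the
  trajectory consists of independent uniform vertices.\<close>

definition uniform_path :: "nat \<Rightarrow> nat \<Rightarrow> (nat \<Rightarrow> nat) pmf" where
  "uniform_path n t = Pi_pmf {..t} 0 (\<lambda>_. pmf_of_set {0..<n})"

definition touched :: "nat \<Rightarrow> (nat \<Rightarrow> nat) \<Rightarrow> nat set set" where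
  "touched t v = {{v i, v (Suc i)} |i. i < t \<and> v i \<noteq> v (Suc i)}"

text \<open>A single fresh graph suffices although pairs may be crossed repeatedly: only the status
  after the last crossing survives, and that is one Bernoulli bit.\<close>

definition refresh :: "nat set set \<Rightarrow> graph \<Rightarrow> graph \<Rightarrow> graph" where
  "refresh T G H = (\<lambda>e. if e \<in> T then H e else G e)"

lemma finite_vertex_pairs [simp]: "finite (vertex_pairs n)"
  by (rule finite_subset[of _ "Pow {0..<n}"]) (auto simp: vertex_pairs_def)

lemma uniform_path_Suc:
  "uniform_path n (Suc t) =
     bind_pmf (uniform_path n t) (\<lambda>v. map_pmf (\<lambda>x. v(Suc t := x)) (pmf_of_set {0..<n}))"
  unfolding uniform_path_def atMost_Suc
  by (subst Pi_pmf_insert', simp, simp, subst bind_commute_pmf) (simp add: map_pmf_def)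

lemma uniform_path_bound:
  assumes "n > 0" "v \<in> set_pmf (uniform_path n t)" "i \<le> t"
  shows "v i < n"
  using assms by (auto simp: uniform_path_def set_Pi_pmf PiE_dflt_def set_pmf_of_set)

lemma touched_Suc_upd:
  "touched (Suc t) (v(Suc t := x)) =
     (if x = v t then touched t v else insert {v t, x} (touched t v))"
  unfolding touched_def by (auto simp: less_Suc_eq)

lemma refresh_insert: "refresh (insert e T) G (H(e := b)) = (refresh T G H)(e := b)"
  by (auto simp: refresh_def fun_eq_iff)

text \<open>Induction on \<open>t\<close> for a fixed start graph \<open>G\<close>. Each crossing
  redraws the bit of the crossed pair; by \<open>Pi_pmf_resample\<close> the redraw can take place
  inside \<open>H\<close> without changing its law.\<close>

lemma edgelighter_walk_law:
  assumes "n > 0"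
  shows "bind_pmf (pmf_of_set {0..<n}) (\<lambda>u. edgelighter_walk n (1 - p) p t (u, G)) =
    bind_pmf (uniform_path n t) (\<lambda>v. map_pmf (\<lambda>H. (v t, refresh (touched t v) G H)) (ER n p))"
proof (induction t)
  case 0
  have "pmf_of_set {0..<n} = map_pmf (\<lambda>v. v 0) (uniform_path n 0)"
    by (simp add: uniform_path_def Pi_pmf_component)
  then show ?case
    by (simp add: touched_def refresh_def map_pmf_def[symmetric] pmf.map_comp o_def)
next
  case (Suc t)
  let ?U = "pmf_of_set {0..<n}"
  let ?r = "\<lambda>v. refresh (touched t v) G"
  have step: "bind_pmf (ER n p) (\<lambda>H. edgelighter_step n (1 - p) p (v t, ?r v H)) =
      bind_pmf ?U (\<lambda>x. map_pmf (\<lambda>H. (x, refresh (touched (Suc t) (v(Suc t := x))) G H)) (ER n p))"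
    if v: "v \<in> set_pmf (uniform_path n t)" for v
  proof -
    \<comment> \<open>As \<open>1 - (1 - p) = p\<close>, the edge and non-edge branches draw from
      the same Bernoulli law, so the old status of the pair drops out.\<close>
    have "bind_pmf (ER n p) (\<lambda>H. edgelighter_step n (1 - p) p (v t, ?r v H)) =
        bind_pmf ?U (\<lambda>x. bind_pmf (ER n p) (\<lambda>H. if x = v t then return_pmf (x, ?r v H)
          else map_pmf (\<lambda>b. (x, (?r v H)({v t, x} := b))) (bernoulli_pmf p)))"
      by (subst bind_commute_pmf) (simp add: edgelighter_step_def cong: if_cong)
    also have "\<dots> = bind_pmf ?U (\<lambda>x. map_pmf (\<lambda>H. (x, refresh (touched (Suc t) (v(Suc t := x))) G H)) (ER n p))"
    proof (intro bind_pmf_cong refl)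
      fix x assume "x \<in> set_pmf ?U"
      then have x: "x < n" using \<open>n > 0\<close> by (simp add: set_pmf_of_set)
      show "bind_pmf (ER n p) (\<lambda>H. if x = v t then return_pmf (x, ?r v H)
          else map_pmf (\<lambda>b. (x, (?r v H)({v t, x} := b))) (bernoulli_pmf p)) =
        map_pmf (\<lambda>H. (x, refresh (touched (Suc t) (v(Suc t := x))) G H)) (ER n p)"
      proof (cases "x = v t")
        case True
        then show ?thesis by (simp add: touched_Suc_upd map_pmf_def)
      next
        case False
        let ?e = "{v t, x}"
        have e: "?e \<in> vertex_pairs n"
          using x False uniform_path_bound[OF \<open>n > 0\<close> v, of t] by (auto simp: vertex_pairs_def)
        \<comment> \<open>A redundant redraw of the bit of \<open>?e\<close> in \<open>H\<close> is
          inserted; \<open>refresh_insert\<close> then turns it into the walk's own update.\<close>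
        have "map_pmf (\<lambda>H. (x, refresh (insert ?e (touched t v)) G H)) (ER n p) =
            map_pmf (\<lambda>H. (x, refresh (insert ?e (touched t v)) G H))
              (bind_pmf (ER n p) (\<lambda>H. map_pmf (\<lambda>b. H(?e := b)) (bernoulli_pmf p)))"
          unfolding ER_def using e by (simp add: Pi_pmf_resample[where p = "\<lambda>_. bernoulli_pmf p"])
        also have "\<dots> = bind_pmf (ER n p) (\<lambda>H. map_pmf (\<lambda>b. (x, (?r v H)(?e := b))) (bernoulli_pmf p))"
          by (simp add: map_bind_pmf pmf.map_comp o_def refresh_insert)
        finally show ?thesis using False by (simp add: touched_Suc_upd)
      qed
    qed
    finally show ?thesis .
  qed
  have "bind_pmf ?U (\<lambda>u. edgelighter_walk n (1 - p) p (Suc t) (u, G)) =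
      bind_pmf (uniform_path n t) (\<lambda>v. bind_pmf (ER n p)
        (\<lambda>H. edgelighter_step n (1 - p) p (v t, ?r v H)))"
    unfolding edgelighter_walk.simps(2) bind_assoc_pmf[symmetric] Suc.IH
    by (simp add: bind_map_pmf bind_assoc_pmf)
  also have "\<dots> = bind_pmf (uniform_path n t) (\<lambda>v. bind_pmf ?U (\<lambda>x.
        map_pmf (\<lambda>H. (x, refresh (touched (Suc t) (v(Suc t := x))) G H)) (ER n p)))"
    by (intro bind_pmf_cong refl step)
  also have "\<dots> = bind_pmf (uniform_path n (Suc t))
      (\<lambda>v. map_pmf (\<lambda>H. (v (Suc t), refresh (touched (Suc t) v) G H)) (ER n p))"
    by (simp add: uniform_path_Suc bind_assoc_pmf bind_map_pmf)
  finally show ?case .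
qed

text \<open>Puts all randomness on one product of independent coordinates, the setting that bounded
  differences require.\<close>

lemma edgelighter_graphs_law:
  assumes "n > 0"
  shows "edgelighter_graphs n p (1 - p) p t =
    map_pmf (\<lambda>(v, G, H). (G, refresh (touched t v) G H))
      (pair_pmf (uniform_path n t) (pair_pmf (ER n p) (ER n p)))"
proof -
  have "edgelighter_graphs n p (1 - p) p t =
      bind_pmf (ER n p) (\<lambda>G. map_pmf (\<lambda>z. (G, snd z))
        (bind_pmf (pmf_of_set {0..<n}) (\<lambda>u. edgelighter_walk n (1 - p) p t (u, G))))"
    unfolding edgelighter_graphs_def pair_pmf_def bind_assoc_pmf bind_return_pmf
    by (subst bind_commute_pmf) (simp add: map_bind_pmf)
  also have "\<dots> = bind_pmf (ER n p) (\<lambda>G. bind_pmf (uniform_path n t) (\<lambda>v.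
      map_pmf (\<lambda>H. (G, refresh (touched t v) G H)) (ER n p)))"
    by (simp add: edgelighter_walk_law[OF assms] map_bind_pmf pmf.map_comp o_def)
  also have "\<dots> = map_pmf (\<lambda>(v, G, H). (G, refresh (touched t v) G H))
      (pair_pmf (uniform_path n t) (pair_pmf (ER n p) (ER n p)))"
    by (subst bind_commute_pmf) (simp add: pair_pmf_def map_pmf_def bind_assoc_pmf bind_return_pmf)
  finally show ?thesis .
qed

subsection \<open>The gain of a permutation\<close>

text \<open>The map from ordered to unordered pairs has fibres made of two orientations. This turns
  traces into edge sums.\<close>

lemma sum_ordered_pairs:
  fixes \<phi> :: "nat set \<Rightarrow> real"
  shows "(\<Sum>i\<in>{0..<n}. \<Sum>j\<in>{0..<n}. if i \<noteq> j then \<phi> {i, j} else 0) = 2 * sum \<phi> (vertex_pairs n)"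
proof -
  define S where "S = {z \<in> {0..<n} \<times> {0..<n}. fst z \<noteq> snd z}"
  define h where "h = (\<lambda>z :: nat \<times> nat. {fst z, snd z})"
  have fin: "finite S" by (simp add: S_def)
  have fibre: "card {z \<in> S. h z = e} = 2" if e: "e \<in> vertex_pairs n" for e
  proof -
    from e obtain a b where ab: "e = {a, b}" "a \<noteq> b" "a < n" "b < n"
      by (auto simp: vertex_pairs_def card_2_iff)
    then have "{z \<in> S. h z = e} = {(a, b), (b, a)}"
      by (auto simp: S_def h_def doubleton_eq_iff)
    then show ?thesis using ab by simp
  qed
  have "(\<Sum>i\<in>{0..<n}. \<Sum>j\<in>{0..<n}. if i \<noteq> j then \<phi> {i, j} else 0) =
      (\<Sum>z\<in>{0..<n} \<times> {0..<n}. if fst z \<noteq> snd z then \<phi> (h z) else 0)"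
    by (simp add: sum.cartesian_product h_def case_prod_unfold cong: if_cong)
  also have "\<dots> = (\<Sum>z\<in>S. \<phi> (h z))"
    unfolding S_def by (rule sum.inter_filter[symmetric]) simp
  also have "\<dots> = (\<Sum>e\<in>vertex_pairs n. \<Sum>z\<in>{z \<in> S. h z = e}. \<phi> (h z))"
    by (rule sum.group[symmetric]) (auto simp: fin S_def h_def vertex_pairs_def)
  also have "\<dots> = (\<Sum>e\<in>vertex_pairs n. 2 * \<phi> e)"
    by (intro sum.cong) (simp_all add: fibre)
  finally show ?thesis by (simp add: sum_distrib_left)
qed

section \<open>Alignment traces as edge sums\<close>

lemma mat_mult_mat:
  "mat n n f * mat n n g = mat n n (\<lambda>(i, j). \<Sum>k\<in>{0..<n}. f (i, k) * (g (k, j) :: real))"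
  by (intro eq_matI) (auto simp: scalar_prod_def)

lemma transpose_perm_mat: "transpose_mat (perm_mat n \<sigma>) = mat n n (\<lambda>(i, j). if \<sigma> j = i then 1 else 0)"
  by (intro eq_matI) (auto simp: perm_mat_def)

lemma mat_trace_mat: "mat_trace (mat n n f) = (\<Sum>i\<in>{0..<n}. f (i, i))"
  by (simp add: mat_trace_def)

lemma trace_adjacency_mult:
  "mat_trace (adjacency_mat n G * adjacency_mat n H) =
     2 * (\<Sum>e\<in>vertex_pairs n. of_bool (G e) * of_bool (H e))"
proof -
  have "mat_trace (adjacency_mat n G * adjacency_mat n H) =
      (\<Sum>i\<in>{0..<n}. \<Sum>j\<in>{0..<n}. if i \<noteq> j then of_bool (G {i, j}) * of_bool (H {i, j}) else 0)"
    by (auto simp: adjacency_mat_def mat_mult_mat mat_trace_mat insert_commute intro!: sum.cong)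
  then show ?thesis by (simp only: sum_ordered_pairs[where n = n and \<phi> = "\<lambda>e. of_bool (G e) * of_bool (H e)"])
qed

text \<open>With this orientation of \<open>perm_mat\<close>, the matrix \<open>P B P^T\<close> has
  the entry of \<open>B\<close> at \<open>(\<sigma> i, \<sigma> j)\<close> in place
  \<open>(i, j)\<close>. Injectivity of \<open>\<sigma>\<close> keeps its diagonal empty.\<close>

lemma trace_adjacency_permuted:
  assumes \<sigma>: "\<sigma> permutes {0..<n}"
  shows "mat_trace (adjacency_mat n G * perm_mat n \<sigma> * adjacency_mat n H * transpose_mat (perm_mat n \<sigma>)) =
     2 * (\<Sum>e\<in>vertex_pairs n. of_bool (G e) * of_bool (H (\<sigma> ` e)))"
proof -
  let ?a = "\<lambda>G i j. if i \<noteq> j \<and> G {i, j} then 1 else 0 :: real"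
  have in_n: "\<sigma> i < n \<longleftrightarrow> i < n" for i using permutes_in_image[OF \<sigma>, of i] by simp
  have inj: "\<sigma> i = \<sigma> j \<longleftrightarrow> i = j" for i j using permutes_inj[OF \<sigma>] by (auto dest: injD)
  have AP: "adjacency_mat n G * perm_mat n \<sigma> =
      mat n n (\<lambda>(i, l). \<Sum>k\<in>{0..<n}. if \<sigma> k = l then ?a G i k else 0)"
    unfolding adjacency_mat_def perm_mat_def mat_mult_mat
    by (intro arg_cong[of _ _ "mat n n"] ext) (auto intro!: sum.cong)
  have APB: "adjacency_mat n G * perm_mat n \<sigma> * adjacency_mat n H =
      mat n n (\<lambda>(i, j). \<Sum>k\<in>{0..<n}. ?a G i k * ?a H (\<sigma> k) j)" (is "_ = mat n n ?C")
  proof -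
    have "(\<Sum>l\<in>{0..<n}. (\<Sum>k\<in>{0..<n}. if \<sigma> k = l then ?a G i k else 0) * ?a H l j) =
        (\<Sum>k\<in>{0..<n}. ?a G i k * ?a H (\<sigma> k) j)" for i j
    proof -
      have "(\<Sum>l\<in>{0..<n}. (\<Sum>k\<in>{0..<n}. if \<sigma> k = l then ?a G i k else 0) * ?a H l j) =
          (\<Sum>l\<in>{0..<n}. \<Sum>k\<in>{0..<n}. if \<sigma> k = l then ?a G i k * ?a H l j else 0)"
        unfolding sum_distrib_right by (intro sum.cong) auto
      also have "\<dots> = (\<Sum>k\<in>{0..<n}. \<Sum>l\<in>{0..<n}. if \<sigma> k = l then ?a G i k * ?a H l j else 0)"
        by (rule sum.swap)
      also have "\<dots> = (\<Sum>k\<in>{0..<n}. ?a G i k * ?a H (\<sigma> k) j)"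
        by (intro sum.cong) (auto simp: sum.delta' in_n)
      finally show ?thesis .
    qed
    then show ?thesis
      unfolding AP unfolding adjacency_mat_def mat_mult_mat prod.case by (simp only:)
  qed
  have "mat_trace (adjacency_mat n G * perm_mat n \<sigma> * adjacency_mat n H * transpose_mat (perm_mat n \<sigma>)) =
      (\<Sum>i\<in>{0..<n}. \<Sum>j\<in>{0..<n}. ?C (i, j) * (if \<sigma> i = j then 1 else 0))"
    unfolding APB transpose_perm_mat mat_mult_mat mat_trace_mat by simp
  \<comment> \<open>The transposed permutation matrix selects the column
    \<open>j = \<sigma> i\<close>.\<close>
  also have "\<dots> = (\<Sum>i\<in>{0..<n}. ?C (i, \<sigma> i))"
  proof (intro sum.cong refl)
    fix i assume "i \<in> {0..<n}"
    have "(\<Sum>j\<in>{0..<n}. ?C (i, j) * (if \<sigma> i = j then 1 else 0)) =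
        (\<Sum>j\<in>{0..<n}. if \<sigma> i = j then ?C (i, j) else 0)"
      by (intro sum.cong) (simp_all del: prod.case)
    then show "(\<Sum>j\<in>{0..<n}. ?C (i, j) * (if \<sigma> i = j then 1 else 0)) = ?C (i, \<sigma> i)"
      using in_n[of i] \<open>i \<in> {0..<n}\<close> by (simp add: sum.delta' del: prod.case)
  qed
  also have "\<dots> = (\<Sum>i\<in>{0..<n}. \<Sum>j\<in>{0..<n}.
      if i \<noteq> j then of_bool (G {i, j}) * of_bool (H (\<sigma> ` {i, j})) else 0)"
    unfolding prod.case
    by (intro sum.cong refl) (auto simp: inj insert_commute)
  finally show ?thesis
    by (simp only: sum_ordered_pairs[where n = n and \<phi> = "\<lambda>e. of_bool (G e) * of_bool (H (\<sigma> ` e))"])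
qed

text \<open>For a permutation, twice this is \<open>Tr(AB) - Tr(APBP^T)\<close>, so a non-positive
  value is exactly a mismatch caused by \<open>\<sigma>\<close>.\<close>

definition gain :: "nat \<Rightarrow> (nat \<Rightarrow> nat) \<Rightarrow> graph \<Rightarrow> graph \<Rightarrow> real" where
  "gain n \<sigma> G H = (\<Sum>e\<in>vertex_pairs n. of_bool (G e) * (of_bool (H e) - of_bool (H (\<sigma> ` e))))"

definition moved :: "nat \<Rightarrow> (nat \<Rightarrow> nat) \<Rightarrow> nat set" where
  "moved n \<sigma> = {i \<in> {0..<n}. \<sigma> i \<noteq> i}"

lemma mismatch_event_gain:
  assumes "(G, H) \<in> mismatch_event \<alpha> n"
  obtains \<sigma> where "\<sigma> permutes {0..<n}" "real (card (moved n \<sigma>)) \<ge> real n powr \<alpha>" "gain n \<sigma> G H \<le> 0"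
proof -
  from assms obtain \<sigma> where \<sigma>: "\<sigma> permutes {0..<n}" "real (card (moved n \<sigma>)) \<ge> real n powr \<alpha>"
    and tr: "mat_trace (adjacency_mat n G * perm_mat n \<sigma> * adjacency_mat n H * transpose_mat (perm_mat n \<sigma>))
      \<ge> mat_trace (adjacency_mat n G * adjacency_mat n H)"
    by (auto simp: mismatch_event_def perm_mats_moving_def moved_def)
  have "gain n \<sigma> G H \<le> 0"
    using tr unfolding trace_adjacency_permuted[OF \<sigma>(1)] trace_adjacency_mult
    by (simp add: gain_def right_diff_distrib sum_subtractf)
  with \<sigma> show thesis by (rule that)
qed

lemma image_vertex_pairs:
  assumes "\<sigma> permutes {0..<n}"
  shows "bij_betw ((`) \<sigma>) (vertex_pairs n) (vertex_pairs n)"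
proof -
  have inj: "inj_on ((`) \<sigma>) (vertex_pairs n)"
    using permutes_inj[OF assms] by (auto intro!: inj_onI simp: inj_image_eq_iff)
  have "(`) \<sigma> ` vertex_pairs n \<subseteq> vertex_pairs n"
    using permutes_in_image[OF assms] permutes_inj[OF assms]
    by (auto simp: vertex_pairs_def card_image inj_on_subset)
  then have "(`) \<sigma> ` vertex_pairs n = vertex_pairs n"
    using inj by (intro endo_inj_surj) auto
  with inj show ?thesis by (simp add: bij_betw_def)
qed

text \<open>A changed bit of \<open>G\<close> moves one summand by at most 1. \<open>H\<close> is
  read both at \<open>e\<close> and at its image, and the image map is a bijection of
  \<open>vertex_pairs n\<close>, so each changed bit of \<open>H\<close> counts twice.\<close>

lemma gain_diff:
  assumes \<sigma>: "\<sigma> permutes {0..<n}"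
  shows "\<bar>gain n \<sigma> G H - gain n \<sigma> G' H'\<bar> \<le>
    real (card {e \<in> vertex_pairs n. G e \<noteq> G' e}) + 2 * real (card {e \<in> vertex_pairs n. H e \<noteq> H' e})"
proof -
  have card: "(\<Sum>e\<in>vertex_pairs n. of_bool (P e)) = real (card {e \<in> vertex_pairs n. P e})" for P
    by (simp add: Int_def)
  have "\<bar>gain n \<sigma> G H - gain n \<sigma> G' H'\<bar> \<le> (\<Sum>e\<in>vertex_pairs n.
      \<bar>of_bool (G e) * (of_bool (H e) - of_bool (H (\<sigma> ` e))) -
       of_bool (G' e) * (of_bool (H' e) - of_bool (H' (\<sigma> ` e)))\<bar>)"
    unfolding gain_def sum_subtractf[symmetric] by (rule sum_abs)
  also have "\<dots> \<le> (\<Sum>e\<in>vertex_pairs n. of_bool (G e \<noteq> G' e) +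
      (of_bool (H e \<noteq> H' e) + of_bool (H (\<sigma> ` e) \<noteq> H' (\<sigma> ` e))))"
    by (intro sum_mono) (simp add: of_bool_def)
  also have "\<dots> = (\<Sum>e\<in>vertex_pairs n. of_bool (G e \<noteq> G' e)) +
      ((\<Sum>e\<in>vertex_pairs n. of_bool (H e \<noteq> H' e)) +
       (\<Sum>e\<in>vertex_pairs n. of_bool (H (\<sigma> ` e) \<noteq> H' (\<sigma> ` e))))"
    by (simp only: sum.distrib)
  also have "(\<Sum>e\<in>vertex_pairs n. of_bool (H (\<sigma> ` e) \<noteq> H' (\<sigma> ` e))) =
      (\<Sum>e\<in>vertex_pairs n. of_bool (H e \<noteq> H' e) :: real)"
    by (rule sum.reindex_bij_betw[OF image_vertex_pairs[OF \<sigma>]])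
  finally show ?thesis unfolding card by simp
qed

text \<open>Vertex \<open>i\<close> of the path enters only the steps into and out of it: at most
  two pairs cease to be touched and at most two become touched.\<close>

lemma refresh_path_diff:
  "card {e \<in> vertex_pairs n. refresh (touched t v) G H e \<noteq> refresh (touched t (v(i := x))) G H e} \<le> 4"
proof -
  \<comment> \<open>For \<open>i = 0\<close> the truncated \<open>i - 1\<close> is \<open>0\<close>;
    this only adds harmless members to \<open>?S\<close>, which need only be a superset.\<close>
  have "{e \<in> vertex_pairs n. refresh (touched t v) G H e \<noteq> refresh (touched t (v(i := x))) G H e} \<subseteq>
      {{v (i - 1), v i}, {v i, v (Suc i)}, {v (i - 1), x}, {x, v (Suc i)}}" (is "_ \<subseteq> ?S")
  proof -
    have 1: "e \<in> touched t (v(i := x))" if "e \<in> touched t v" "e \<notin> ?S" for e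
    proof -
      from that(1) obtain j where "j < t" "v j \<noteq> v (Suc j)" "e = {v j, v (Suc j)}"
        unfolding touched_def by blast
      moreover from this that have "j \<noteq> i" "Suc j \<noteq> i" by auto
      ultimately show ?thesis unfolding touched_def by force
    qed
    have 2: "e \<in> touched t v" if e: "e \<in> touched t (v(i := x))" "e \<notin> ?S" for e
    proof -
      from e obtain j where j: "j < t" "(v(i := x)) j \<noteq> (v(i := x)) (Suc j)"
          "e = {(v(i := x)) j, (v(i := x)) (Suc j)}"
        unfolding touched_def by blast
      have "j \<noteq> i"
      proof
        assume "j = i"
        with j(3) have "e = {x, v (Suc i)}" by simp
        with e(2) show False by simp
      qed
      moreover have "Suc j \<noteq> i"
      proof
        assume "Suc j = i"
        with j(3) have "e = {v (i - 1), x}" by auto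
        with e(2) show False by simp
      qed
      ultimately show ?thesis using j unfolding touched_def by auto
    qed
    show ?thesis
    proof (rule subsetI, rule ccontr)
      fix e assume e: "e \<in> {e \<in> vertex_pairs n. refresh (touched t v) G H e \<noteq> refresh (touched t (v(i := x))) G H e}"
        and "e \<notin> ?S"
      with 1[of e] 2[of e] have "e \<in> touched t v \<longleftrightarrow> e \<in> touched t (v(i := x))" by blast
      with e show False by (simp add: refresh_def)
    qed
  qed
  then have "card {e \<in> vertex_pairs n. refresh (touched t v) G H e \<noteq> refresh (touched t (v(i := x))) G H e}
      \<le> card ?S"
    by (intro card_mono) auto
  also have "\<dots> \<le> 4"
    using card_length[of "[{v (i - 1), v i}, {v i, v (Suc i)}, {v (i - 1), x}, {x, v (Suc i)}]"] by simp
  finally show ?thesis .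
qed

section \<open>Counting pairs and permutations by moved labels\<close>

definition moved_pairs :: "nat \<Rightarrow> (nat \<Rightarrow> nat) \<Rightarrow> nat set set" where
  "moved_pairs n \<sigma> = {e \<in> vertex_pairs n. \<sigma> ` e \<noteq> e}"

text \<open>If \<open>i\<close> is moved, then so is the pair \<open>{i, j}\<close> for every
  \<open>j\<close> other than \<open>i\<close> and \<open>\<sigma> i\<close>, since
  \<open>\<sigma> i\<close> lies in the image but not in the pair. The choice
  \<open>j = \<sigma> i\<close> is excluded because swapping two labels fixes their pair. Each pair
  is counted from at most two endpoints, hence the factor 2.\<close>

lemma card_moved_pairs:
  assumes \<sigma>: "\<sigma> permutes {0..<n}"
  shows "2 * real (card (moved_pairs n \<sigma>)) \<ge> real (card (moved n \<sigma>)) * (real n - 2)"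
proof -
  have inj: "\<sigma> i = \<sigma> j \<longleftrightarrow> i = j" for i j using permutes_inj[OF \<sigma>] by (auto dest: injD)
  have "real (card (moved n \<sigma>)) * (real n - 2) = (\<Sum>i\<in>moved n \<sigma>. real n - 2)" by simp
  also have "\<dots> \<le> (\<Sum>i\<in>moved n \<sigma>. \<Sum>j\<in>{0..<n}. if i \<noteq> j then of_bool (\<sigma> ` {i, j} \<noteq> {i, j}) else 0)"
  proof (rule sum_mono)
    fix i assume i: "i \<in> moved n \<sigma>"
    have "real n - 2 \<le> real (card ({0..<n} - {i, \<sigma> i}))"
    proof -
      have "card {0..<n} - card {i, \<sigma> i} \<le> card ({0..<n} - {i, \<sigma> i})" by (rule diff_card_le_card_Diff) simp
      moreover have "card {i, \<sigma> i} \<le> 2" by (simp add: card_insert_if)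
      ultimately show ?thesis by simp
    qed
    also have "\<dots> = (\<Sum>j\<in>{0..<n} - {i, \<sigma> i}. 1)" by simp
    also have "\<dots> \<le> (\<Sum>j\<in>{0..<n} - {i, \<sigma> i}. if i \<noteq> j then of_bool (\<sigma> ` {i, j} \<noteq> {i, j}) else 0)"
      using i by (intro sum_mono) (auto simp: moved_def)
    also have "\<dots> \<le> (\<Sum>j\<in>{0..<n}. if i \<noteq> j then of_bool (\<sigma> ` {i, j} \<noteq> {i, j}) else 0)"
      by (intro sum_mono2) auto
    finally show "real n - 2 \<le> (\<Sum>j\<in>{0..<n}. if i \<noteq> j then of_bool (\<sigma> ` {i, j} \<noteq> {i, j}) else 0)" .
  qed
  also have "\<dots> \<le> (\<Sum>i\<in>{0..<n}. \<Sum>j\<in>{0..<n}. if i \<noteq> j then of_bool (\<sigma> ` {i, j} \<noteq> {i, j}) else 0)"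
    by (intro sum_mono2) (auto simp: moved_def intro!: sum_nonneg)
  also have "\<dots> = 2 * (\<Sum>e\<in>vertex_pairs n. of_bool (\<sigma> ` e \<noteq> e))"
    by (rule sum_ordered_pairs)
  also have "(\<Sum>e\<in>vertex_pairs n. of_bool (\<sigma> ` e \<noteq> e)) = real (card (moved_pairs n \<sigma>))"
    by (simp add: moved_pairs_def Int_def)
  finally show ?thesis .
qed

text \<open>A permutation is determined by its graph over the moved labels, a set of
  \<open>k\<close> among \<open>n * n\<close> points. The crudeness of the count costs only a
  constant factor in its logarithm.\<close>

lemma card_permutations_moving:
  "card {\<sigma>. \<sigma> permutes {0..<n} \<and> card (moved n \<sigma>) = k} \<le> n ^ (2 * k)"
proof -
  let ?P = "{\<sigma>. \<sigma> permutes {0..<n} \<and> card (moved n \<sigma>) = k}"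
  let ?g = "\<lambda>\<sigma>. (\<lambda>i. (i, \<sigma> i)) ` moved n \<sigma>"
  let ?B = "{B. B \<subseteq> {0..<n} \<times> {0..<n} \<and> card B = k}"
  have "inj_on ?g ?P"
  proof (rule inj_onI, rule ext)
    fix \<sigma> \<tau> i assume *: "\<sigma> \<in> ?P" "\<tau> \<in> ?P" "?g \<sigma> = ?g \<tau>"
    have "(i, \<rho> i) \<in> ?g \<rho>" if "\<rho> permutes {0..<n}" "\<rho> i \<noteq> i" for \<rho>
      using that permutes_not_in[OF that(1), of i] by (auto simp: moved_def)
    then have "\<sigma> i \<noteq> i \<Longrightarrow> (i, \<sigma> i) \<in> ?g \<sigma>" "\<tau> i \<noteq> i \<Longrightarrow> (i, \<tau> i) \<in> ?g \<tau>"
      using * by blast+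
    with *(3) have "\<sigma> i \<noteq> i \<Longrightarrow> \<sigma> i = \<tau> i" "\<tau> i \<noteq> i \<Longrightarrow> \<tau> i = \<sigma> i"
      by (auto simp: image_iff)
    then show "\<sigma> i = \<tau> i" by metis
  qed
  moreover have "?g ` ?P \<subseteq> ?B"
  proof (rule image_subsetI)
    fix \<sigma> assume \<sigma>: "\<sigma> \<in> ?P"
    then have "card (?g \<sigma>) = k" by (subst card_image) (auto intro: inj_onI)
    from \<sigma> have "\<sigma> permutes {0..<n}" by simp
    then have "\<sigma> j \<in> {0..<n}" if "j \<in> moved n \<sigma>" for j
      using that by (simp only: permutes_in_image) (simp add: moved_def)
    then have "?g \<sigma> \<subseteq> {0..<n} \<times> {0..<n}"
      by (intro image_subsetI SigmaI) (auto simp: moved_def)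
    with \<open>card (?g \<sigma>) = k\<close> show "?g \<sigma> \<in> ?B" by simp
  qed
  moreover have "finite ?B" by (rule finite_subset[of _ "Pow ({0..<n} \<times> {0..<n})"]) auto
  ultimately have "card ?P \<le> card ?B" by (rule card_inj_on_le)
  also have "\<dots> = (n * n) choose k" by (simp add: n_subsets)
  also have "\<dots> \<le> (n * n) ^ k"
  proof (cases "k \<le> n * n")
    case True
    then show ?thesis by (rule binomial_le_pow)
  next
    case False
    then have "n * n choose k = 0" by (intro binomial_eq_0) simp
    then show ?thesis by (simp only: le0)
  qed
  also have "\<dots> = n ^ (2 * k)" by (simp only: power_mult power2_eq_square)
  finally show ?thesis .
qed

subsection \<open>Mean and tail of the gain\<close>

lemma expectation_pair_pmf_finite':
  fixes f :: "'a \<times> 'b \<Rightarrow> real"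
  assumes "finite (set_pmf A)" "finite (set_pmf B)"
  shows "measure_pmf.expectation (pair_pmf A B) f =
    measure_pmf.expectation A (\<lambda>x. measure_pmf.expectation B (\<lambda>y. f (x, y)))"
  using expectation_pair_pmf_finite[OF assms(2,1), of "\<lambda>(y, x). f (x, y)"]
  by (subst pair_commute_pmf) (simp add: case_prod_unfold)

lemma finite_set_bernoulli [simp]: "finite (set_pmf (bernoulli_pmf p))"
  by (rule finite_subset[of _ UNIV]) auto

lemma finite_set_ER [simp]: "finite (set_pmf (ER n p))"
  unfolding ER_def by (rule finite_set_Pi_pmf) auto

lemma finite_set_uniform_path [simp]: "n > 0 \<Longrightarrow> finite (set_pmf (uniform_path n t))"
  unfolding uniform_path_def by (rule finite_set_Pi_pmf) auto

lemma expectation_ER_prod: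
  assumes p: "0 \<le> p" "p \<le> 1" and S: "S \<subseteq> vertex_pairs n"
  shows "measure_pmf.expectation (ER n p) (\<lambda>G. \<Prod>e\<in>S. of_bool (G e)) = p ^ card S"
proof -
  \<comment> \<open>Padding with factors 1 outside \<open>S\<close> gives a product over all
    coordinates, which independence factorises.\<close>
  let ?f = "\<lambda>e b. if e \<in> S then of_bool b else 1 :: real"
  have "(\<Prod>e\<in>S. of_bool (G e)) = (\<Prod>e\<in>vertex_pairs n. ?f e (G e))" for G
    using S by (intro prod.mono_neutral_cong_left) auto
  then have "measure_pmf.expectation (ER n p) (\<lambda>G. \<Prod>e\<in>S. of_bool (G e)) =
      (\<Prod>e\<in>vertex_pairs n. measure_pmf.expectation (bernoulli_pmf p) (?f e))"
    unfolding ER_def by (simp only:)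
      (intro expectation_prod_Pi_pmf; simp add: integrable_measure_pmf_finite)
  also have "\<dots> = (\<Prod>e\<in>vertex_pairs n. if e \<in> S then p else 1)"
    using p by (intro prod.cong) auto
  also have "\<dots> = (\<Prod>e\<in>S. p)"
    using S by (intro prod.mono_neutral_cong_right) auto
  finally show ?thesis by simp
qed

lemma expectation_ER_edge:
  assumes "0 \<le> p" "p \<le> 1" "e \<in> vertex_pairs n"
  shows "measure_pmf.expectation (ER n p) (\<lambda>G. of_bool (G e)) = p"
  using expectation_ER_prod[of p "{e}" n] assms by simp

text \<open>The two indicators are dependent only if they read the same bit, that is, for the same
  pair not replaced from \<open>H\<close>. Then the product is the indicator itself; otherwise two
  independent bits are multiplied.\<close>

lemma expectation_edge_refresh:
  assumes p: "0 \<le> p" "p \<le> 1" and e: "e \<in> vertex_pairs n" "e' \<in> vertex_pairs n"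
  shows "measure_pmf.expectation (pair_pmf (ER n p) (ER n p))
      (\<lambda>(G, H). of_bool (G e) * of_bool (refresh T G H e')) =
    (if e = e' \<and> e \<notin> T then p else p\<^sup>2)"
proof (cases "e' \<in> T")
  case True
  then show ?thesis
    using assms by (auto simp: expectation_pair_pmf_finite refresh_def expectation_ER_edge power2_eq_square)
next
  case False
  have "measure_pmf.expectation (ER n p) (\<lambda>G. of_bool (G e) * of_bool (G e')) = p\<^sup>2" if "e \<noteq> e'"
    using expectation_ER_prod[of p "{e, e'}" n] that assms by (simp add: power2_eq_square)
  then show ?thesis
    using assms False by (auto simp: expectation_pair_pmf_finite refresh_def expectation_ER_edge simp flip: of_bool_conj)
qed

text \<open>Fixed pairs cancel term by term. For a moved pair the permuted term has mean
  \<open>p\<^sup>2\<close>, so only untouched moved pairs contribute, each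
  \<open>p - p\<^sup>2\<close>.\<close>

lemma expectation_gain:
  assumes p: "0 \<le> p" "p \<le> 1" and \<sigma>: "\<sigma> permutes {0..<n}"
  shows "measure_pmf.expectation (pair_pmf (ER n p) (ER n p)) (\<lambda>(G, H). gain n \<sigma> G (refresh T G H)) =
    p * (1 - p) * (\<Sum>e\<in>moved_pairs n \<sigma>. of_bool (e \<notin> T))"
proof -
  let ?M = "pair_pmf (ER n p) (ER n p)"
  let ?E = "\<lambda>e e'. measure_pmf.expectation ?M (\<lambda>(G, H). of_bool (G e) * of_bool (refresh T G H e'))"
  have int: "integrable (measure_pmf ?M) f" for f :: "_ \<Rightarrow> real"
    by (rule integrable_measure_pmf_finite) simp
  have "measure_pmf.expectation ?M (\<lambda>(G, H). gain n \<sigma> G (refresh T G H)) =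
      (\<Sum>e\<in>vertex_pairs n. ?E e e - ?E e (\<sigma> ` e))"
    by (simp add: gain_def case_prod_unfold right_diff_distrib int Bochner_Integration.integral_sum
       )
  also have "\<dots> = (\<Sum>e\<in>vertex_pairs n. if \<sigma> ` e \<noteq> e then p * (1 - p) * of_bool (e \<notin> T) else 0)"
  proof (intro sum.cong refl)
    fix e assume e: "e \<in> vertex_pairs n"
    then have e': "\<sigma> ` e \<in> vertex_pairs n"
      using bij_betwE[OF image_vertex_pairs[OF \<sigma>]] by blast
    show "?E e e - ?E e (\<sigma> ` e) = (if \<sigma> ` e \<noteq> e then p * (1 - p) * of_bool (e \<notin> T) else 0)"
      unfolding expectation_edge_refresh[OF p e e] expectation_edge_refresh[OF p e e']
      by (auto simp: algebra_simps power2_eq_square)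
  qed
  also have "\<dots> = (\<Sum>e\<in>moved_pairs n \<sigma>. p * (1 - p) * of_bool (e \<notin> T))"
    unfolding moved_pairs_def by (rule sum.inter_filter[symmetric]) simp
  finally show ?thesis by (simp add: sum_distrib_left)
qed

section \<open>Probability that a pair stays untouched\<close>

lemma expectation_uniform:
  fixes f :: "nat \<Rightarrow> real"
  assumes "n > 0"
  shows "measure_pmf.expectation (pmf_of_set {0..<n}) f = (\<Sum>x\<in>{0..<n}. f x) / n"
  using assms by (simp add: integral_pmf_of_set)

lemma expectation_uniform_path_Suc:
  fixes f :: "(nat \<Rightarrow> nat) \<Rightarrow> real"
  assumes "n > 0"
  shows "measure_pmf.expectation (uniform_path n (Suc t)) f =
    measure_pmf.expectation (uniform_path n t) (\<lambda>v. (\<Sum>x\<in>{0..<n}. f (v(Suc t := x))) / n)"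
proof -
  have "uniform_path n (Suc t) =
      map_pmf (\<lambda>(v, x). v(Suc t := x)) (pair_pmf (uniform_path n t) (pmf_of_set {0..<n}))"
    by (simp add: uniform_path_Suc pair_pmf_def map_pmf_def bind_assoc_pmf bind_return_pmf)
  then show ?thesis
    using assms by (simp add: expectation_pair_pmf_finite' expectation_uniform)
qed

text \<open>With \<open>a\<^sub>t\<close> the probability that \<open>e\<close> is untouched and \<open>b\<^sub>t\<close> the probability that moreover the walker
  sits on \<open>e\<close>, one has \<open>a\<^sub>t\<^sub>+\<^sub>1 = a\<^sub>t - b\<^sub>t / n\<close>, and \<open>b\<^sub>t \<le> 2 a\<^sub>t / (n - 1)\<close> is invariant.\<close>

lemma untouched_probability:
  assumes n: "n \<ge> 2" and e: "e \<in> vertex_pairs n"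
  shows "(1 - 2 / (real n * (real n - 1))) ^ t \<le>
    measure_pmf.expectation (uniform_path n t) (\<lambda>v. of_bool (e \<notin> touched t v))"
proof -
  define a :: "nat \<Rightarrow> real" where "a = (\<lambda>t. measure_pmf.expectation (uniform_path n t) (\<lambda>v. of_bool (e \<notin> touched t v)))"
  define b :: "nat \<Rightarrow> real" where "b = (\<lambda>t. measure_pmf.expectation (uniform_path n t)
    (\<lambda>v. of_bool (e \<notin> touched t v) * of_bool (v t \<in> e)))"
  have n0: "n > 0" using n by simp
  have fin: "finite (set_pmf (uniform_path n t))" for t using n0 by simp
  have int: "integrable (measure_pmf (uniform_path n t)) f" for t and f :: "_ \<Rightarrow> real"
    by (rule integrable_measure_pmf_finite[OF fin])
  obtain c d where cd: "e = {c, d}" "c \<noteq> d" "c < n" "d < n"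
    using e by (auto simp: vertex_pairs_def card_2_iff)
  have iff: "e \<notin> touched (Suc t) (v(Suc t := x)) \<longleftrightarrow> e \<notin> touched t v \<and> {v t, x} \<noteq> e" for t v x
    using cd by (auto simp: touched_Suc_upd doubleton_eq_iff)
  \<comment> \<open>From an endpoint of \<open>e\<close> exactly one target completes
    \<open>e\<close>; from any other vertex none does.\<close>
  have hit: "(\<Sum>x\<in>{0..<n}. of_bool ({u, x} = e)) = (of_bool (u \<in> e) :: real)" for u
  proof -
    have "{0..<n} \<inter> {x. {u, x} = e} = (if u = c then {d} else if u = d then {c} else {})"
      using cd by (auto simp: doubleton_eq_iff)
    then show ?thesis using cd by (auto simp: sum_of_bool_eq)
  qed
  have two: "(\<Sum>x\<in>{0..<n}. of_bool (x \<in> e)) = (2 :: real)"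
  proof -
    have "(\<Sum>x\<in>{0..<n}. of_bool (x \<in> e)) = (\<Sum>x\<in>e. 1 :: real)"
      using cd by (intro sum.mono_neutral_cong_right) auto
    then show ?thesis using cd by simp
  qed
  have a_Suc: "a (Suc t) = a t - b t / n" for t
  proof -
    have "(\<Sum>x\<in>{0..<n}. of_bool (e \<notin> touched (Suc t) (v(Suc t := x)))) / n =
        of_bool (e \<notin> touched t v) - of_bool (e \<notin> touched t v) * of_bool (v t \<in> e) / n" for v
    proof -
      have "(\<Sum>x\<in>{0..<n}. of_bool (e \<notin> touched (Suc t) (v(Suc t := x)))) =
          (\<Sum>x\<in>{0..<n}. of_bool (e \<notin> touched t v) * (1 - of_bool ({v t, x} = e)) :: real)"
        unfolding iff by (intro sum.cong) auto
      also have "\<dots> = of_bool (e \<notin> touched t v) * (real n - of_bool (v t \<in> e))"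
        unfolding sum_distrib_left[symmetric] sum_subtractf hit by simp
      finally show ?thesis using n0 by (simp add: field_simps)
    qed
    then have "a (Suc t) = measure_pmf.expectation (uniform_path n t)
        (\<lambda>v. of_bool (e \<notin> touched t v) - of_bool (e \<notin> touched t v) * of_bool (v t \<in> e) / n)"
      unfolding a_def expectation_uniform_path_Suc[OF n0] by simp
    then show ?thesis by (simp add: int a_def b_def)
  qed
  \<comment> \<open>Discarding the condition that the last step misses \<open>e\<close> leaves two
    targets out of \<open>n\<close>.\<close>
  have b_Suc: "b (Suc t) \<le> 2 / n * a t" for t
  proof -
    have "(\<Sum>x\<in>{0..<n}. of_bool (e \<notin> touched (Suc t) (v(Suc t := x))) *
          of_bool ((v(Suc t := x)) (Suc t) \<in> e)) / n \<le> of_bool (e \<notin> touched t v) * (2 / n :: real)" for v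
    proof -
      have "(\<Sum>x\<in>{0..<n}. of_bool (e \<notin> touched (Suc t) (v(Suc t := x))) *
          of_bool ((v(Suc t := x)) (Suc t) \<in> e)) \<le>
          (\<Sum>x\<in>{0..<n}. of_bool (e \<notin> touched t v) * of_bool (x \<in> e) :: real)"
        unfolding iff by (intro sum_mono) auto
      also have "\<dots> = of_bool (e \<notin> touched t v) * 2"
        unfolding sum_distrib_left[symmetric] two ..
      finally show ?thesis by (simp add: divide_right_mono)
    qed
    then have "b (Suc t) \<le> measure_pmf.expectation (uniform_path n t)
        (\<lambda>v. of_bool (e \<notin> touched t v) * (2 / n))"
      unfolding b_def expectation_uniform_path_Suc[OF n0]
      by (intro expectation_mono_finite[OF fin])
    then show ?thesis by (simp add: a_def mult.commute)
  qed
  have a_nonneg: "a t \<ge> 0" for t unfolding a_def by simp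
  have b_le_a: "b t \<le> a t" for t
    unfolding a_def b_def by (intro expectation_mono_finite[OF fin]) simp
  \<comment> \<open>A case distinction replaces induction: \<open>b_Suc\<close> bounds
    \<open>b\<close> by the preceding \<open>a\<close>, and \<open>b_le_a\<close> shows that one
    step keeps at least the fraction \<open>1 - 1 / n\<close> of \<open>a\<close>.\<close>
  have inv: "b t \<le> 2 / (real n - 1) * a t" for t
  proof (cases t)
    case 0
    have start: "map_pmf (\<lambda>v. v 0) (uniform_path n 0) = pmf_of_set {0..<n}"
      by (simp add: uniform_path_def Pi_pmf_component)
    have "measure_pmf.expectation (uniform_path n 0) (\<lambda>v. of_bool (v 0 \<in> e)) =
        measure_pmf.expectation (pmf_of_set {0..<n}) (\<lambda>x. of_bool (x \<in> e) :: real)"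
      unfolding start[symmetric] by simp
    then have "b 0 = 2 / n" "a 0 = 1"
      using n0 two by (simp_all add: a_def b_def touched_def expectation_uniform)
    moreover have "2 / real n \<le> 2 / (real n - 1)" using n by (intro divide_left_mono) auto
    ultimately show ?thesis using 0 by simp
  next
    case (Suc s)
    have "a s * (1 - 1 / n) \<le> a (Suc s)"
      unfolding a_Suc using b_le_a[of s] n0 by (simp add: field_simps)
    then have "a s \<le> n / (real n - 1) * a (Suc s)" using n by (simp add: field_simps)
    then have "2 / n * a s \<le> 2 / n * (n / (real n - 1) * a (Suc s))"
      by (intro mult_left_mono) auto
    also have "\<dots> = 2 / (real n - 1) * a (Suc s)" using n by simp
    finally show ?thesis using b_Suc[of s] Suc by simp
  qed
  have "(1 - 2 / (real n * (real n - 1))) ^ t \<le> a t"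
  proof (induction t)
    case 0
    then show ?case by (simp add: a_def touched_def)
  next
    case (Suc t)
    have q: "0 \<le> 1 - 2 / (real n * (real n - 1))"
    proof -
      have "2 * 1 \<le> real n * (real n - 1)" using n by (intro mult_mono) auto
      then show ?thesis using n by simp
    qed
    have "(1 - 2 / (real n * (real n - 1))) ^ Suc t \<le> (1 - 2 / (real n * (real n - 1))) * a t"
      using Suc.IH q by (simp add: mult_left_mono)
    also have "\<dots> = a t - 2 / (real n - 1) * a t / n" using n by (simp add: field_simps)
    also have "\<dots> \<le> a t - b t / n" using inv[of t] by (intro diff_left_mono divide_right_mono) auto
    finally show ?case by (simp add: a_Suc)
  qed
  then show ?thesis by (simp add: a_def)
qed

text \<open>Averages \<open>expectation_gain\<close> over the path. By linearity only the survival
  of single pairs matters, not their joint behaviour.\<close>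

lemma expectation_gain_path:
  assumes p: "0 \<le> p" "p \<le> 1" and \<sigma>: "\<sigma> permutes {0..<n}" and n: "n \<ge> 2"
  shows "measure_pmf.expectation (pair_pmf (uniform_path n t) (pair_pmf (ER n p) (ER n p)))
      (\<lambda>(v, G, H). gain n \<sigma> G (refresh (touched t v) G H)) \<ge>
    p * (1 - p) * (real (card (moved n \<sigma>)) * (real n - 2) / 2) * (1 - 2 / (real n * (real n - 1))) ^ t"
proof -
  let ?q = "(1 - 2 / (real n * (real n - 1))) ^ t"
  have fin: "finite (set_pmf (uniform_path n t))" using n by simp
  have q: "?q \<ge> 0"
  proof -
    have "2 * 1 \<le> real n * (real n - 1)" using n by (intro mult_mono) auto
    then show ?thesis using n by (intro zero_le_power) simp
  qed
  have "p * (1 - p) * (real (card (moved n \<sigma>)) * (real n - 2) / 2) * ?q \<le>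
      p * (1 - p) * real (card (moved_pairs n \<sigma>)) * ?q"
    using card_moved_pairs[OF \<sigma>] p q by (intro mult_right_mono mult_left_mono) auto
  also have "\<dots> = p * (1 - p) * (\<Sum>e\<in>moved_pairs n \<sigma>. ?q)" by simp
  also have "\<dots> \<le> p * (1 - p) * (\<Sum>e\<in>moved_pairs n \<sigma>.
      measure_pmf.expectation (uniform_path n t) (\<lambda>v. of_bool (e \<notin> touched t v)))"
    using p n by (intro mult_left_mono sum_mono untouched_probability) (auto simp: moved_pairs_def)
  also have "\<dots> = measure_pmf.expectation (uniform_path n t)
      (\<lambda>v. p * (1 - p) * (\<Sum>e\<in>moved_pairs n \<sigma>. of_bool (e \<notin> touched t v)))"
    by (simp add: Bochner_Integration.integral_sum integrable_measure_pmf_finite[OF fin])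
  also have "\<dots> = measure_pmf.expectation (uniform_path n t) (\<lambda>v.
      measure_pmf.expectation (pair_pmf (ER n p) (ER n p)) (\<lambda>(G, H). gain n \<sigma> G (refresh (touched t v) G H)))"
    by (simp only: expectation_gain[OF p \<sigma>])
  also have "\<dots> = measure_pmf.expectation (pair_pmf (uniform_path n t) (pair_pmf (ER n p) (ER n p)))
      (\<lambda>(v, G, H). gain n \<sigma> G (refresh (touched t v) G H))"
    by (subst expectation_pair_pmf_finite') (auto simp: fin)
  finally show ?thesis .
qed

section \<open>Tail of the gain for a single permutation\<close>

lemma card_vertex_pairs_le: "card (vertex_pairs n) \<le> n\<^sup>2"
proof -
  have "card (vertex_pairs n) = n choose 2"
    unfolding vertex_pairs_def by (subst n_subsets) auto
  also have "\<dots> \<le> n\<^sup>2"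
  proof (cases "2 \<le> n")
    case True
    then show ?thesis by (rule binomial_le_pow)
  next
    case False
    then have "n choose 2 = 0" by (intro binomial_eq_0) simp
    then show ?thesis by (simp only: le0)
  qed
  finally show ?thesis .
qed

text \<open>A change of one path vertex alters at most 4 touched pairs, hence the gain by at most 8; a change
  of one edge of \<open>G\<close> or \<open>H\<close> alters it by at most 3 or 2, and \<open>13 = 3\<^sup>2 + 2\<^sup>2\<close>.\<close>

lemma subgaussian_gain:
  assumes \<sigma>: "\<sigma> permutes {0..<n}" and n: "n > 0"
  shows "subgaussian (pair_pmf (uniform_path n t) (pair_pmf (ER n p) (ER n p)))
    (\<lambda>(v, G, H). - gain n \<sigma> G (refresh (touched t v) G H))
    (64 * (real t + 1) + 13 * real (card (vertex_pairs n)))"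
proof -
  let ?V = "uniform_path n t" and ?N = "real (card (vertex_pairs n))"
  \<comment> \<open>The sign is flipped because \<open>subgaussian_tail\<close> bounds upper
    tails.\<close>
  let ?f = "\<lambda>(v, G, H). - gain n \<sigma> G (refresh (touched t v) G H)"
  have fin: "finite (set_pmf ?V)" using n by simp
  have card1: "card {e' \<in> vertex_pairs n. P e'} \<le> 1" if "\<And>e'. P e' \<Longrightarrow> e' = e" for P e
    using that card_mono[of "{e}" "{e' \<in> vertex_pairs n. P e'}"] by auto
  have "subgaussian (pair_pmf ?V (pair_pmf (ER n p) (ER n p))) ?f
      ((\<Sum>i\<in>{..t}. 8\<^sup>2) + ((\<Sum>e\<in>vertex_pairs n. 3\<^sup>2) + (\<Sum>e\<in>vertex_pairs n. 2\<^sup>2)))"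
  \<comment> \<open>The inputs are averaged out in the order path, \<open>G\<close>,
    \<open>H\<close>; averaging preserves the oscillation in those that remain.\<close>
  proof (intro subgaussian_pair)
    show "subgaussian ?V (\<lambda>v. ?f (v, y)) (\<Sum>i\<in>{..t}. 8\<^sup>2)" for y
      unfolding uniform_path_def
    proof (intro subgaussian_bounded_differences)
      fix i v x
      obtain G H where y: "y = (G, H)" by fastforce
      show "\<bar>?f (v(i := x), y) - ?f (v, y)\<bar> \<le> 8"
        using gain_diff[OF \<sigma>, of G "refresh (touched t v) G H" G "refresh (touched t (v(i := x))) G H"]
          refresh_path_diff[of n t v G H i x]
        unfolding y prod.case by simp
    qed (use n in auto)
    show "subgaussian (ER n p) (\<lambda>G. measure_pmf.expectation ?V (\<lambda>v. ?f (v, (G, H))))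
        (\<Sum>e\<in>vertex_pairs n. 3\<^sup>2)" for H
      unfolding ER_def
    proof (intro subgaussian_bounded_differences expectation_diff_le fin)
      fix e G v and b :: bool
      \<comment> \<open>A flipped bit of \<open>G\<close> also shows in the refreshed graph unless
        its pair is touched, hence \<open>1 + 2\<close>; a bit of \<open>H\<close> enters only
        through the refreshed graph.\<close>
      have "card {e' \<in> vertex_pairs n. (G(e := b)) e' \<noteq> G e'} \<le> 1"
        by (rule card1[of _ e]) (auto split: if_splits)
      moreover have "card {e' \<in> vertex_pairs n. refresh (touched t v) (G(e := b)) H e' \<noteq>
          refresh (touched t v) G H e'} \<le> 1"
        by (rule card1[of _ e]) (auto simp: refresh_def split: if_splits)
      ultimately show "\<bar>?f (v, (G(e := b), H)) - ?f (v, (G, H))\<bar> \<le> 3"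
        using gain_diff[OF \<sigma>, of "G(e := b)" "refresh (touched t v) (G(e := b)) H" G "refresh (touched t v) G H"]
        unfolding prod.case by linarith
    qed auto
    show "subgaussian (ER n p) (\<lambda>H. measure_pmf.expectation (ER n p)
          (\<lambda>G. measure_pmf.expectation ?V (\<lambda>v. ?f (v, (G, H))))) (\<Sum>e\<in>vertex_pairs n. 2\<^sup>2)"
      unfolding ER_def[of n p]
    proof (intro subgaussian_bounded_differences expectation_diff_le fin)
      fix e G H v and b :: bool
      have "card {e' \<in> vertex_pairs n. refresh (touched t v) G (H(e := b)) e' \<noteq>
          refresh (touched t v) G H e'} \<le> 1"
        by (rule card1[of _ e]) (auto simp: refresh_def split: if_splits)
      then show "\<bar>?f (v, (G, H(e := b))) - ?f (v, (G, H))\<bar> \<le> 2"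
        using gain_diff[OF \<sigma>, of G "refresh (touched t v) G (H(e := b))" G "refresh (touched t v) G H"]
        unfolding prod.case by simp
    qed (auto simp flip: ER_def)
  qed (auto simp: fin)
  then show ?thesis by (simp add: algebra_simps)
qed

text \<open>The mean gain is at least \<open>\<delta>\<close>, so a non-positive gain is a deviation
  by at least \<open>\<delta>\<close>, to which the sub-Gaussian tail applies.\<close>

lemma gain_tail:
  assumes p: "0 < p" "p < 1" and \<sigma>: "\<sigma> permutes {0..<n}" and n: "n \<ge> 3"
    and k: "card (moved n \<sigma>) > 0"
  shows "measure_pmf.prob (edgelighter_graphs n p (1 - p) p t) {(G, H). gain n \<sigma> G H \<le> 0} \<le>
    exp (- 2 * (p * (1 - p) * (real (card (moved n \<sigma>)) * (real n - 2) / 2) *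
        (1 - 2 / (real n * (real n - 1))) ^ t)\<^sup>2 / (64 * (real t + 1) + 13 * (real n)\<^sup>2))"
proof -
  let ?M = "pair_pmf (uniform_path n t) (pair_pmf (ER n p) (ER n p))"
  let ?f = "\<lambda>(v, G, H). - gain n \<sigma> G (refresh (touched t v) G H)"
  let ?K = "64 * (real t + 1) + 13 * real (card (vertex_pairs n))"
  let ?K' = "64 * (real t + 1) + 13 * (real n)\<^sup>2"
  define \<delta> where "\<delta> = p * (1 - p) * (real (card (moved n \<sigma>)) * (real n - 2) / 2) *
        (1 - 2 / (real n * (real n - 1))) ^ t"
  \<comment> \<open>Strictness uses \<open>n \<ge> 3\<close>: for \<open>n = 2\<close> this base is
    0.\<close>
  have q: "0 < 1 - 2 / (real n * (real n - 1))"
  proof -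
    have "3 * 2 \<le> real n * (real n - 1)" using n by (intro mult_mono) auto
    then show ?thesis using n by (simp add: field_simps)
  qed
  have \<delta>: "\<delta> > 0" unfolding \<delta>_def using p n k q by (intro mult_pos_pos zero_less_power) auto
  have K: "0 < ?K" "?K \<le> ?K'"
    using card_vertex_pairs_le[of n] by (auto simp flip: of_nat_power intro: add_pos_nonneg)
  have "0 < ?K'" using K by linarith
  have E: "measure_pmf.expectation ?M ?f + \<delta> \<le> 0"
  proof -
    have "measure_pmf.expectation ?M ?f =
        - measure_pmf.expectation ?M (\<lambda>(v, G, H). gain n \<sigma> G (refresh (touched t v) G H))"
      unfolding case_prod_unfold by simp
    then show ?thesis
      using expectation_gain_path[of p \<sigma> n t] p \<sigma> n unfolding \<delta>_def by simp
  qed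
  have "measure_pmf.prob (edgelighter_graphs n p (1 - p) p t) {(G, H). gain n \<sigma> G H \<le> 0} =
      measure_pmf.prob ?M {x. ?f x \<ge> 0}"
    using n by (simp add: edgelighter_graphs_law vimage_def case_prod_unfold)
  also have "\<dots> \<le> measure_pmf.prob ?M {x. ?f x \<ge> measure_pmf.expectation ?M ?f + \<delta>}"
    using E by (intro measure_pmf.finite_measure_mono) auto
  also have "\<dots> \<le> exp (- 2 * \<delta>\<^sup>2 / ?K)"
    using n \<sigma> K \<delta> by (intro subgaussian_tail subgaussian_gain) auto
  also have "\<dots> \<le> exp (- 2 * \<delta>\<^sup>2 / ?K')"
    using K \<open>0 < ?K'\<close> by (auto intro!: divide_left_mono mult_pos_pos)
  finally show ?thesis unfolding \<delta>_def .
qed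

subsection \<open>Union bound and asymptotics\<close>

text \<open>With \<open>x = 2 / (n (n - 1))\<close>, the bounds
  \<open>ln (1 - x) \<ge> - x - 2 * x\<^sup>2\<close> and \<open>t \<le> c n\<^sup>2 ln n\<close>
  put the logarithm of the survival bound at about \<open>- 2 c ln n\<close> or above. Taking
  \<open>5 / 2\<close> instead of \<open>2\<close> absorbs lower-order terms; squaring later
  produces the exponent \<open>5 * c\<close>.\<close>

lemma eventually_pair_survival:
  fixes c :: real
  assumes "c > 0"
  shows "eventually (\<lambda>n :: nat. \<forall>t :: nat. real t \<le> c * real n ^ 2 * ln (real n) \<longrightarrow>
    real n powr (- (5 * c / 2)) \<le> (1 - 2 / (real n * (real n - 1))) ^ t) sequentially"
proof -
  have "eventually (\<lambda>n :: nat. real n ^ 2 * (2 / (real n * (real n - 1)) +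
      2 * (2 / (real n * (real n - 1)))\<^sup>2) \<le> 5 / 2) sequentially"
    by real_asymp
  then show ?thesis using eventually_ge_at_top[of 3]
  proof eventually_elim
    case (elim n)
    define x where "x = 2 / (real n * (real n - 1))"
    have "3 * 2 \<le> real n * (real n - 1)" using elim by (intro mult_mono) auto
    then have x: "0 \<le> x" "x \<le> 1 / 2" using elim by (auto simp: x_def field_simps)
    show ?case
    proof (intro allI impI)
      fix t :: nat assume t: "real t \<le> c * real n ^ 2 * ln (real n)"
      have L: "0 \<le> c * ln (real n)" using elim assms by simp
      have "real t * (x + 2 * x\<^sup>2) \<le> c * real n ^ 2 * ln (real n) * (x + 2 * x\<^sup>2)"
        using t x by (intro mult_right_mono) auto
      also have "\<dots> = c * ln (real n) * (real n ^ 2 * (x + 2 * x\<^sup>2))" by simp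
      also have "\<dots> \<le> c * ln (real n) * (5 / 2)"
        using elim(1) L unfolding x_def by (intro mult_left_mono) auto
      finally have 1: "- (5 * c / 2) * ln (real n) \<le> real t * (- x - 2 * x\<^sup>2)"
        by (simp add: algebra_simps)
      also have "\<dots> \<le> real t * ln (1 - x)"
        using ln_one_minus_pos_lower_bound[of x] x by (intro mult_left_mono) auto
      finally have "exp (- (5 * c / 2) * ln (real n)) \<le> exp (real t * ln (1 - x))" by simp
      also have "\<dots> = (1 - x) ^ t" using x by (simp add: exp_of_nat_mult)
      finally show "real n powr (- (5 * c / 2)) \<le> (1 - 2 / (real n * (real n - 1))) ^ t"
        using elim by (simp add: powr_def x_def)
    qed
  qed
qed

text \<open>For \<open>k\<close> moved labels the mean gain is at least
  \<open>\<delta>' = p (1 - p) k (n / 4) n powr (- 5 c / 2)\<close>, and the variance proxy is at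
  most \<open>K' = (64 c + 14) n\<^sup>2 ln n\<close>. The constant \<open>C\<close> is what remains
  of \<open>2 * \<delta>'\<^sup>2 / K'\<close>, its 8 coming from \<open>2 / 16\<close>.\<close>

lemma eventually_gain_tail:
  fixes p c :: real
  assumes p: "0 < p" "p < 1" and c: "c > 0"
  defines "C \<equiv> (p * (1 - p))\<^sup>2 / (8 * (64 * c + 14))"
  shows "eventually (\<lambda>n :: nat. \<forall>t :: nat. real t \<le> c * real n ^ 2 * ln (real n) \<longrightarrow>
    (\<forall>\<sigma>. \<sigma> permutes {0..<n} \<longrightarrow> card (moved n \<sigma>) > 0 \<longrightarrow>
      measure_pmf.prob (edgelighter_graphs n p (1 - p) p t) {(G, H). gain n \<sigma> G H \<le> 0} \<le>
      exp (- (C * real (card (moved n \<sigma>)) ^ 2 * real n powr (- (5 * c)) / ln (real n))))) sequentially"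
  using eventually_pair_survival[OF c] eventually_ge_at_top[of 8]
proof eventually_elim
  case (elim n)
  have "exp 1 \<le> (3 :: real)" by (rule exp_le)
  then have "exp 1 \<le> real n" using elim by linarith
  then have ln1: "ln (real n) \<ge> 1" using elim by (simp add: ln_ge_iff)
  show ?case
  proof (intro allI impI)
    fix t :: nat and \<sigma>
    assume t: "real t \<le> c * real n ^ 2 * ln (real n)"
      and \<sigma>: "\<sigma> permutes {0..<n}" and k: "card (moved n \<sigma>) > 0"
    define k where "k = real (card (moved n \<sigma>))"
    define \<delta> where "\<delta> = p * (1 - p) * (k * (real n - 2) / 2) * (1 - 2 / (real n * (real n - 1))) ^ t"
    define K where "K = 64 * (real t + 1) + 13 * (real n)\<^sup>2"
    define K' where "K' = (64 * c + 14) * ((real n)\<^sup>2 * ln (real n))"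
    define \<delta>' where "\<delta>' = p * (1 - p) * (k * (real n / 4)) * real n powr (- (5 * c / 2))"
    have "k * (real n / 4) \<le> k * ((real n - 2) / 2)"
      using elim(2) by (intro mult_left_mono) (auto simp: k_def)
    then have "\<delta>' \<le> \<delta>"
      unfolding \<delta>_def \<delta>'_def using p elim(1)[rule_format, OF t] elim(2)
      by (intro mult_mono) (auto simp: k_def)
    moreover have "0 \<le> \<delta>'" using p by (simp add: \<delta>'_def k_def)
    ultimately have sq: "\<delta>'\<^sup>2 \<le> \<delta>\<^sup>2" by (intro power_mono)
    \<comment> \<open>From \<open>n \<ge> 8\<close> the additive 64 is at most
      \<open>n\<^sup>2\<close>, which turns 13 into 14; \<open>ln n \<ge> 1\<close> then brings in
      the logarithm.\<close>
    have "K \<le> K'"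
    proof -
      have "8 * 8 \<le> real n * real n" using elim by (intro mult_mono) auto
      then have "64 \<le> (real n)\<^sup>2" by (simp add: power2_eq_square)
      moreover define Y where "Y = (real n)\<^sup>2 * ln (real n)"
      moreover have "(real n)\<^sup>2 * 1 \<le> Y" unfolding Y_def using ln1 by (intro mult_left_mono) auto
      moreover define X where "X = c * real n ^ 2 * ln (real n)"
      moreover have "K' = 64 * X + 14 * Y"
        by (simp add: K'_def X_def Y_def algebra_simps)
      moreover have "real t \<le> X" using t by (simp add: X_def)
      ultimately show ?thesis unfolding K_def by simp
    qed
    have "0 < K" unfolding K_def by (intro add_pos_nonneg) auto
    have "C * k\<^sup>2 * real n powr (- (5 * c)) / ln (real n) = 2 * \<delta>'\<^sup>2 / K'"
    proof -
      have "(real n powr (- (5 * c / 2)))\<^sup>2 = real n powr (- (5 * c))"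
        using elim by (simp add: power2_eq_square flip: powr_add)
      then have "2 * \<delta>'\<^sup>2 / K' = 2 * ((p * (1 - p))\<^sup>2 * (k\<^sup>2 * ((real n)\<^sup>2 / 16)) * real n powr (- (5 * c))) / K'"
        by (simp add: \<delta>'_def power_mult_distrib power_divide)
      also have "\<dots> = C * k\<^sup>2 * real n powr (- (5 * c)) / ln (real n)"
        using elim ln1 c by (simp add: K'_def C_def divide_simps)
      finally show ?thesis ..
    qed
    also have "\<dots> \<le> 2 * \<delta>\<^sup>2 / K"
      using sq \<open>K \<le> K'\<close> \<open>0 < K\<close> by (intro frac_le) auto
    finally have "exp (- 2 * \<delta>\<^sup>2 / K) \<le> exp (- (C * k\<^sup>2 * real n powr (- (5 * c)) / ln (real n)))" by simp
    moreover have "measure_pmf.prob (edgelighter_graphs n p (1 - p) p t) {(G, H). gain n \<sigma> G H \<le> 0}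
        \<le> exp (- 2 * \<delta>\<^sup>2 / K)"
      using gain_tail[OF p \<sigma> _ k, of t] elim unfolding \<delta>_def K_def k_def by simp
    ultimately show "measure_pmf.prob (edgelighter_graphs n p (1 - p) p t) {(G, H). gain n \<sigma> G H \<le> 0} \<le>
        exp (- (C * real (card (moved n \<sigma>)) ^ 2 * real n powr (- (5 * c)) / ln (real n)))"
      unfolding k_def by linarith
  qed
qed

text \<open>Half of the exponent pays for the at most \<open>n ^ (2 * k)\<close> permutations and
  half survives. Hypothesis \<open>D\<close> expresses this at \<open>k = n powr \<alpha>\<close>;
  larger \<open>k\<close> inherit it, as the exponent is quadratic in \<open>k\<close> and the
  logarithm of the count linear. Summing over \<open>k \<le> n\<close> costs the factor
  \<open>n + 1\<close>.\<close>

lemma mismatch_union_bound: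
  fixes C \<alpha> \<gamma> :: real
  assumes n: "n \<ge> 2" and C: "C > 0"
    and D: "4 * ln (real n) \<le> C * real n powr (\<alpha> - \<gamma>) / ln (real n)"
    and tail: "\<And>\<sigma>. \<sigma> permutes {0..<n} \<Longrightarrow> card (moved n \<sigma>) > 0 \<Longrightarrow>
      measure_pmf.prob \<mu> {(G, H). gain n \<sigma> G H \<le> 0} \<le>
      exp (- (C * real (card (moved n \<sigma>)) ^ 2 * real n powr (- \<gamma>) / ln (real n)))"
  shows "measure_pmf.prob \<mu> (mismatch_event \<alpha> n) \<le>
    (real n + 1) * exp (- (C / 2 * real n powr (2 * \<alpha> - \<gamma>) / ln (real n)))"
proof -
  define S where "S = {k \<in> {..n}. real k \<ge> real n powr \<alpha>}"
  define P where "P = (\<lambda>k. {\<sigma>. \<sigma> permutes {0..<n} \<and> card (moved n \<sigma>) = k})"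
  let ?g = "\<lambda>k. exp (- (C * real k ^ 2 * real n powr (- \<gamma>) / ln (real n)))"
  have finP: "finite (P k)" for k
    by (rule finite_subset[OF _ finite_permutations[of "{0..<n}"]]) (auto simp: P_def)
  have L: "ln (real n) > 0" using n by simp
  have summand: "real n ^ (2 * k) * ?g k \<le> exp (- (C / 2 * real n powr (2 * \<alpha> - \<gamma>) / ln (real n)))"
    if "k \<in> S" for k
  proof -
    from that have k: "real n powr \<alpha> \<le> real k" by (simp add: S_def)
    define b where "b = C * real n powr (- \<gamma>) / ln (real n)"
    have b: "b \<ge> 0" using C L by (simp add: b_def)
    have "4 * ln (real n) \<le> b * real n powr \<alpha>"
      using D n by (simp add: b_def powr_diff powr_minus field_simps)
    also have "\<dots> \<le> b * real k" using k b by (rule mult_left_mono)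
    finally have "(real k / 2) * (4 * ln (real n)) \<le> (real k / 2) * (b * real k)"
      by (intro mult_left_mono) auto
    then have 1: "2 * real k * ln (real n) \<le> b * real k ^ 2 / 2"
      by (simp add: power2_eq_square algebra_simps)
    have "real n powr (2 * \<alpha>) \<le> real k ^ 2"
      using power_mono[OF k, of 2] n by (simp add: power2_eq_square flip: powr_add)
    then have "b * real n powr (2 * \<alpha>) \<le> b * real k ^ 2" using b by (rule mult_left_mono)
    moreover have "C / 2 * real n powr (2 * \<alpha> - \<gamma>) / ln (real n) = b * real n powr (2 * \<alpha>) / 2"
      using n by (simp add: b_def powr_diff powr_minus field_simps)
    ultimately have 2: "2 * real k * ln (real n) - b * real k ^ 2 \<le>
        - (C / 2 * real n powr (2 * \<alpha> - \<gamma>) / ln (real n))"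
      using 1 by linarith
    have "real n ^ (2 * k) = exp (2 * real k * ln (real n))"
      using n exp_of_nat_mult[of "2 * k" "ln (real n)"] by simp
    then have "real n ^ (2 * k) * ?g k = exp (2 * real k * ln (real n) - b * real k ^ 2)"
      by (simp add: b_def mult_exp_exp algebra_simps)
    also have "\<dots> \<le> exp (- (C / 2 * real n powr (2 * \<alpha> - \<gamma>) / ln (real n)))"
      using 2 by simp
    finally show ?thesis .
  qed
  have "mismatch_event \<alpha> n \<subseteq> (\<Union>k\<in>S. \<Union>\<sigma>\<in>P k. {(G, H). gain n \<sigma> G H \<le> 0})"
  proof
    fix z assume "z \<in> mismatch_event \<alpha> n"
    moreover obtain G H where z: "z = (G, H)" by fastforce
    ultimately obtain \<sigma> where \<sigma>: "\<sigma> permutes {0..<n}" "real (card (moved n \<sigma>)) \<ge> real n powr \<alpha>"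
        "gain n \<sigma> G H \<le> 0"
      using mismatch_event_gain by metis
    have "card (moved n \<sigma>) \<le> card {0..<n}" by (intro card_mono) (auto simp: moved_def)
    with \<sigma> have "card (moved n \<sigma>) \<in> S" "\<sigma> \<in> P (card (moved n \<sigma>))" by (auto simp: S_def P_def)
    with \<sigma>(3) show "z \<in> (\<Union>k\<in>S. \<Union>\<sigma>\<in>P k. {(G, H). gain n \<sigma> G H \<le> 0})" unfolding z by blast
  qed
  then have "measure_pmf.prob \<mu> (mismatch_event \<alpha> n) \<le>
      measure_pmf.prob \<mu> (\<Union>k\<in>S. \<Union>\<sigma>\<in>P k. {(G, H). gain n \<sigma> G H \<le> 0})"
    by (intro measure_pmf.finite_measure_mono) auto
  also have "\<dots> \<le> (\<Sum>k\<in>S. measure_pmf.prob \<mu> (\<Union>\<sigma>\<in>P k. {(G, H). gain n \<sigma> G H \<le> 0}))"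
    by (intro measure_pmf.finite_measure_subadditive_finite) (auto simp: S_def)
  also have "\<dots> \<le> (\<Sum>k\<in>S. \<Sum>\<sigma>\<in>P k. measure_pmf.prob \<mu> {(G, H). gain n \<sigma> G H \<le> 0})"
    by (intro sum_mono measure_pmf.finite_measure_subadditive_finite) (auto simp: finP)
  also have "\<dots> \<le> (\<Sum>k\<in>S. \<Sum>\<sigma>\<in>P k. ?g k)"
  proof (intro sum_mono)
    fix k \<sigma> assume k: "k \<in> S" and \<sigma>: "\<sigma> \<in> P k"
    \<comment> \<open>The tail bound covers only permutations other than the identity; positivity of
      the threshold excludes \<open>k = 0\<close>.\<close>
    have "0 < real n powr \<alpha>" using n by simp
    with k have "k > 0" unfolding S_def by (cases "k = 0") auto
    with tail[of \<sigma>] \<sigma> show "measure_pmf.prob \<mu> {(G, H). gain n \<sigma> G H \<le> 0} \<le> ?g k"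
      by (simp add: P_def)
  qed
  also have "\<dots> = (\<Sum>k\<in>S. real (card (P k)) * ?g k)" by simp
  also have "\<dots> \<le> (\<Sum>k\<in>S. real n ^ (2 * k) * ?g k)"
    using card_permutations_moving[of n] unfolding P_def
    by (intro sum_mono mult_right_mono) (auto simp flip: of_nat_power)
  also have "\<dots> \<le> (\<Sum>k\<in>S. exp (- (C / 2 * real n powr (2 * \<alpha> - \<gamma>) / ln (real n))))"
    by (intro sum_mono summand)
  also have "\<dots> = real (card S) * exp (- (C / 2 * real n powr (2 * \<alpha> - \<gamma>) / ln (real n)))" by simp
  also have "\<dots> \<le> (real n + 1) * exp (- (C / 2 * real n powr (2 * \<alpha> - \<gamma>) / ln (real n)))"
  proof (intro mult_right_mono)
    have "card S \<le> card {..n}" by (intro card_mono) (auto simp: S_def)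
    then show "real (card S) \<le> real n + 1" by simp
  qed simp
  finally show ?thesis .
qed

section \<open>Growth comparisons and conclusion\<close>

lemma eventually_log_sq_le_powr:
  fixes C \<beta> :: real
  assumes "C > 0" "\<beta> > 0"
  shows "eventually (\<lambda>n :: nat. 4 * ln (real n) \<le> C * real n powr \<beta> / ln (real n)) sequentially"
  using assms by real_asymp

lemma eventually_ln_Suc_le_powr:
  fixes C \<beta> :: real
  assumes "C > 0" "\<beta> > 0"
  shows "eventually (\<lambda>n :: nat. ln (real n + 1) \<le> C * real n powr \<beta> / ln (real n)) sequentially"
  using assms by real_asymp

lemma exp_powr_div_ln_tendsto:
  fixes C \<beta> :: real
  assumes "C > 0" "\<beta> > 0"
  shows "(\<lambda>n :: nat. 2 * exp (- (C * (real n powr \<beta> / ln (real n))))) \<longlonglongrightarrow> 0"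
  using assms by real_asymp

theorem theorem1:
  fixes p q1 q2 \<alpha> c :: real
  assumes "0 < p" and "p < 1"
    and "1 - q1 = p" and "q2 = p"
    and "\<alpha> > 0" and "c > 0" and "\<alpha> > 5 * c"
  shows "(\<forall>t :: nat \<Rightarrow> nat. (\<forall>n. real (t n) \<le> c * real n ^ 2 * ln (real n)) \<longrightarrow>
            alpha_matchable \<alpha> (\<lambda>n. edgelighter_graphs n p q1 q2 (t n)))
       \<and> (\<exists>C > 0. \<exists>n0 :: nat. \<forall>n \<ge> n0. \<forall>t :: nat. real t \<le> c * real n ^ 2 * ln (real n) \<longrightarrow>
            measure_pmf.prob (edgelighter_graphs n p q1 q2 t) (mismatch_event \<alpha> n)
              \<le> 2 * exp (- (C * (real n powr (2 * \<alpha> - 5 * c) / ln (real n)))))"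
proof -
  have q: "q1 = 1 - p" "q2 = p" using assms by simp_all
  define D where "D = (p * (1 - p))\<^sup>2 / (8 * (64 * c + 14))"
  have D: "D > 0" using assms by (simp add: D_def)
  \<comment> \<open>The union bound leaves the constant \<open>D / 2\<close>; half of that is spent
    on absorbing the factor \<open>n + 1\<close>.\<close>
  define C where "C = D / 4"
  have C: "C > 0" using D by (simp add: C_def)
  have \<beta>: "2 * \<alpha> - 5 * c > 0" using assms by simp
  have "\<alpha> - 5 * c > 0" using assms by simp
  \<comment> \<open>The time \<open>t\<close> is quantified inside \<open>eventually\<close>, so the
    bound is uniform in \<open>t\<close> and applies along any admissible sequence of times.\<close>
  from eventually_log_sq_le_powr[OF D this] eventually_ln_Suc_le_powr[OF C \<beta>]
    eventually_gain_tail[OF assms(1,2,6)] eventually_ge_at_top[of 2]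
  have ev: "eventually (\<lambda>n :: nat. \<forall>t :: nat. real t \<le> c * real n ^ 2 * ln (real n) \<longrightarrow>
      measure_pmf.prob (edgelighter_graphs n p q1 q2 t) (mismatch_event \<alpha> n)
        \<le> 2 * exp (- (C * (real n powr (2 * \<alpha> - 5 * c) / ln (real n))))) sequentially"
  proof eventually_elim
    case (elim n)
    show ?case
    proof (intro allI impI)
      fix t :: nat assume t: "real t \<le> c * real n ^ 2 * ln (real n)"
      define E where "E = C * (real n powr (2 * \<alpha> - 5 * c) / ln (real n))"
      have "measure_pmf.prob (edgelighter_graphs n p (1 - p) p t) (mismatch_event \<alpha> n) \<le>
          (real n + 1) * exp (- (D / 2 * real n powr (2 * \<alpha> - 5 * c) / ln (real n)))"
        by (rule mismatch_union_bound[OF elim(4) D elim(1)], unfold D_def)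
          (rule elim(3)[rule_format, OF t])
      also have "\<dots> = (real n + 1) * exp (- (2 * E))" by (simp add: E_def C_def)
      also have "\<dots> \<le> exp E * exp (- (2 * E))"
      proof (rule mult_right_mono)
        have "ln (real n + 1) \<le> E" using elim(2) by (simp add: E_def)
        then have "exp (ln (real n + 1)) \<le> exp E" by (simp only: exp_le_cancel_iff)
        then show "real n + 1 \<le> exp E" by simp
      qed simp
      also have "\<dots> = exp (- E)" by (simp flip: exp_add)
      also have "\<dots> \<le> 2 * exp (- E)" by simp
      finally show "measure_pmf.prob (edgelighter_graphs n p q1 q2 t) (mismatch_event \<alpha> n)
          \<le> 2 * exp (- (C * (real n powr (2 * \<alpha> - 5 * c) / ln (real n))))"
        unfolding q E_def .
    qed
  qed
  have "alpha_matchable \<alpha> (\<lambda>n. edgelighter_graphs n p q1 q2 (t n))"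
    if "\<forall>n. real (t n) \<le> c * real n ^ 2 * ln (real n)" for t :: "nat \<Rightarrow> nat"
    unfolding alpha_matchable_def
  proof (rule tendsto_sandwich[OF _ _ tendsto_const exp_powr_div_ln_tendsto[OF C \<beta>]])
    show "eventually (\<lambda>n. measure_pmf.prob (edgelighter_graphs n p q1 q2 (t n)) (mismatch_event \<alpha> n)
        \<le> 2 * exp (- (C * (real n powr (2 * \<alpha> - 5 * c) / ln (real n))))) sequentially"
      using ev by eventually_elim (use that in blast)
  qed simp
  moreover have "\<exists>C > 0. \<exists>n0 :: nat. \<forall>n \<ge> n0. \<forall>t :: nat. real t \<le> c * real n ^ 2 * ln (real n) \<longrightarrow>
            measure_pmf.prob (edgelighter_graphs n p q1 q2 t) (mismatch_event \<alpha> n)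
              \<le> 2 * exp (- (C * (real n powr (2 * \<alpha> - 5 * c) / ln (real n))))"
    using C ev unfolding eventually_sequentially by blast
  ultimately show ?thesis by blast
qed

end
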